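(* Let $q$ be a prime power that is a square and let $k=3t$ with $t\ge1$ an integer. The code $\mathcal{D}_{k,q}$ defined in the context is a minimal $\left[(q+\sqrt q+1)\frac{2k^2}{9},\,k,\,d\right]_q$ code, where $d\ge q\left(\frac43k-2\right)$.
   Context: Codes: for $v\in\mathbb{F}_q^n$ the support is $\sigma(v)=\{i: v_i\neq0\}$ and the weight is $\omega(v)=|\sigma(v)|$. An $[n,k,d]_q$ code is a $k$-dimensional $\mathbb{F}_q$-linear subspace of $\mathbb{F}_q^n$ whose nonzero codewords have minimum weight $d$. A nonzero codeword $c\in\mathcal{C}$ is minimal if every $c'\in\mathcal{C}$ with $\sigma(c')\subseteq\sigma(c)$ is a scalar multiple of $c$; the code is minimal if all its nonzero codewords are minimal. Construction of $\mathcal{D}_{k,q}$: let $\gamma$ be a primitive element of $\mathbb{F}_{q^3}$ (a generator of $\mathbb{F}_{q^3}^*$), let $M\in\mathbb{F}_q^{3\times3}$ be the companion matrix of its minimal polynomial over $\mathbb{F}_q$, and let $\phi:\mathbb{F}_{q^3}\to\mathbb{F}_q[M]$ be the $\mathbb{F}_q$-algebra isomorphism with $\phi(\gamma)=M$. For a point $P=[(v_1,\dots,v_t)]\in\mathrm{PG}(t-1,q^3)$ let $\bar\varphi(P)\subseteq\mathbb{F}_q^{3t}$ be the $\mathbb{F}_q$-row space of the $3\times3t$ matrix $(\phi(v_1)\mid\cdots\mid\phi(v_t))$; this is a 3-dimensional subspace (independent of the representative), i.e. a plane of $\mathrm{PG}(k-1,q)$. With $e_1,\dots,e_t$ the standard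 basis of $\mathbb{F}_{q^3}^t$, put $P_\ell=[e_\ell]$ and $Q_{\ell,m,i}=[e_\ell+\gamma^ie_m]$ for $1\le\ell<m\le t$. For every pair $1\le\ell<m\le t$ choose $i_{\ell,m},j_{\ell,m}\in\{1,\dots,q^3-1\}$ with $j_{\ell,m}-i_{\ell,m}\not\equiv0\bmod(q^2+q+1)$. The $t^2$ planes $\bar\varphi(P_\ell)$ $(1\le\ell\le t)$, $\bar\varphi(Q_{\ell,m,i_{\ell,m}})$ and $\bar\varphi(Q_{\ell,m,j_{\ell,m}})$ $(1\le\ell<m\le t)$ of $\mathrm{PG}(k-1,q)$ are pairwise disjoint. In each of these planes choose two disjoint Baer subplanes (a Baer subplane of $\mathrm{PG}(2,q)$ is a subgeometry isomorphic to $\mathrm{PG}(2,\sqrt q)$). $\mathcal{D}_{k,q}$ is the code generated by a matrix with $k$ rows whose columns are vector representatives (one for each point) of all the points in the union of these $2t^2$ Baer subplanes. *)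

theory Defs
  imports "HOL-Library.Cardinality" "HOL-Algebra.QuotRing" "Jordan_Normal_Form.VS_Connect"
begin

text \<open>
  A finite field of order \<open>q\<close> is a type of class \<open>{finite, field}\<close> with \<open>q\<close> elements.
  An inclusion of such fields, e.g. of \<open>F_q\<close> in \<open>F_(q^3)\<close>, is a \<open>field_hom\<close>.  Indices into
  vectors and matrices start at 0.
\<close>

subsection \<open>Linear codes\<close>

definition support :: "'a::zero vec \<Rightarrow> nat set" where
  "support v = {i. i < dim_vec v \<and> v $ i \<noteq> 0}"

definition weight :: "'a::zero vec \<Rightarrow> nat" where
  "weight v = card (support v)"

text \<open>The subspaces of vector space dimension \<open>r\<close> in \<open>F^n\<close>.\<close>

definition subspaces_of_dim :: "nat \<Rightarrow> nat \<Rightarrow> 'a::field vec set set" where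
  "subspaces_of_dim n r =
     {W. subspace class_ring W (module_vec TYPE('a) n) \<and>
         vectorspace.dim class_ring ((module_vec TYPE('a) n)\<lparr>carrier := W\<rparr>) = r}"

definition linear_code :: "nat \<Rightarrow> nat \<Rightarrow> nat \<Rightarrow> 'a::field vec set \<Rightarrow> bool" where
  "linear_code n k d C \<longleftrightarrow>
     C \<in> subspaces_of_dim n k \<and>
     (\<exists>c\<in>C. c \<noteq> 0\<^sub>v n \<and> weight c = d) \<and>
     (\<forall>c\<in>C. c \<noteq> 0\<^sub>v n \<longrightarrow> d \<le> weight c)"

definition minimal_codeword :: "'a::field vec set \<Rightarrow> 'a vec \<Rightarrow> bool" where
  "minimal_codeword C c \<longleftrightarrow>
     (\<forall>c'\<in>C. support c' \<subseteq> support c \<longrightarrow> (\<exists>a. c' = a \<cdot>\<^sub>v c))"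

definition minimal_code :: "nat \<Rightarrow> 'a::field vec set \<Rightarrow> bool" where
  "minimal_code n C \<longleftrightarrow> (\<forall>c\<in>C. c \<noteq> 0\<^sub>v n \<longrightarrow> minimal_codeword C c)"

subsection \<open>Projective geometry\<close>

text \<open>
  The points, lines and planes of \<open>PG(n - 1, F)\<close> are the elements of \<open>subspaces_of_dim n 1\<close>,
  \<open>subspaces_of_dim n 2\<close> and \<open>subspaces_of_dim n 3\<close>; incidence is inclusion.
\<close>

definition points_in :: "nat \<Rightarrow> 'a::field vec set \<Rightarrow> 'a vec set set" where
  "points_in n U = {P \<in> subspaces_of_dim n 1. P \<subseteq> U}"

definition proj_point :: "'a::field vec \<Rightarrow> 'a vec set" where
  "proj_point v = LinearCombinations.module.span class_ring (module_vec TYPE('a) (dim_vec v)) {v}"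

text \<open>
  \<open>B\<close> is a Baer subplane of the plane \<open>\<pi>\<close> of \<open>PG(n - 1, 'a)\<close>: the geometry induced on \<open>B\<close>,
  whose lines are the intersections of \<open>B\<close> with the lines of \<open>\<pi>\<close> having at least two points in
  \<open>B\<close>, is isomorphic to \<open>PG(2, 'c)\<close>, where \<open>'c\<close> is the field whose order is the square root of
  the order of \<open>'a\<close>.
\<close>

definition baer_subplane ::
    "'c::{finite,field} itself \<Rightarrow> nat \<Rightarrow> 'a::{finite,field} vec set \<Rightarrow> 'a vec set set \<Rightarrow> bool" where
  "baer_subplane _ n \<pi> B \<longleftrightarrow>
     CARD('c)^2 = CARD('a) \<and>
     B \<subseteq> points_in n \<pi> \<and>
     (\<exists>f. bij_betw f (subspaces_of_dim 3 1 :: 'c vec set set) B \<and>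
          (\<lambda>L. f ` points_in 3 L) ` (subspaces_of_dim 3 2 :: 'c vec set set) =
            {points_in n L \<inter> B | L. L \<in> subspaces_of_dim n 2 \<and> L \<subseteq> \<pi> \<and>
                                   card (points_in n L \<inter> B) \<ge> 2})"

subsection \<open>Field reduction\<close>

definition primitive_element :: "'b::field \<Rightarrow> bool" where
  "primitive_element \<gamma> \<longleftrightarrow> range (\<lambda>n::nat. \<gamma> ^ n) = - {0}"

definition is_min_poly :: "('a::field \<Rightarrow> 'b::field) \<Rightarrow> 'b \<Rightarrow> 'a poly \<Rightarrow> bool" where
  "is_min_poly emb x p \<longleftrightarrow>
     lead_coeff p = 1 \<and> poly (map_poly emb p) x = 0 \<and>
     (\<forall>r. r \<noteq> 0 \<and> poly (map_poly emb r) x = 0 \<longrightarrow> degree p \<le> degree r)"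

definition companion_matrix :: "'a::comm_ring_1 poly \<Rightarrow> 'a mat" where
  "companion_matrix p = mat (degree p) (degree p)
     (\<lambda>(r, c). if c + 1 = degree p then - coeff p r else if r = c + 1 then 1 else 0)"

definition poly_of_mat :: "'a::field poly \<Rightarrow> 'a mat \<Rightarrow> 'a mat" where
  "poly_of_mat p M = mat (dim_row M) (dim_row M)
     (\<lambda>(r, c). \<Sum>i\<le>degree p. coeff p i * (M ^\<^sub>m i) $$ (r, c))"

text \<open>
  The ring \<open>F[M]\<close> of polynomial expressions in a square matrix \<open>M\<close>, as a subring of the full
  matrix ring.
\<close>

definition mat_algebra :: "'a::field mat \<Rightarrow> 'a mat ring" where
  "mat_algebra M =
     (ring_mat TYPE('a) (dim_row M) ())\<lparr>carrier := range (\<lambda>p. poly_of_mat p M)\<rparr>"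

definition is_mat_algebra_iso :: "('a::field \<Rightarrow> 'b::field) \<Rightarrow> 'a mat \<Rightarrow> ('b \<Rightarrow> 'a mat) \<Rightarrow> bool" where
  "is_mat_algebra_iso emb M \<phi> \<longleftrightarrow>
     \<phi> \<in> ring_iso class_ring (mat_algebra M) \<and>
     (\<forall>a x. \<phi> (emb a * x) = a \<cdot>\<^sub>m \<phi> x)"

text \<open>The block matrix \<open>(\<phi> v_1 | ... | \<phi> v_t)\<close> with blocks of size 3 by 3.\<close>

definition block_row :: "('b \<Rightarrow> 'a mat) \<Rightarrow> 'b vec \<Rightarrow> 'a mat" where
  "block_row \<phi> v = mat 3 (3 * dim_vec v) (\<lambda>(r, c). \<phi> (v $ (c div 3)) $$ (r, c mod 3))"

text \<open>
  The plane associated with a point \<open>P\<close> is computed from an arbitrary representative of \<open>P\<close>; it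
  does not depend on that representative when \<open>\<phi>\<close> is multiplicative.
\<close>

definition field_reduction ::
    "('b::field \<Rightarrow> 'a::field mat) \<Rightarrow> nat \<Rightarrow> 'b vec set \<Rightarrow> 'a vec set" where
  "field_reduction \<phi> t P =
     vec_space.row_space (3 * t) (block_row \<phi> (SOME v. v \<in> P \<and> v \<noteq> 0\<^sub>v t))"

definition P_point :: "nat \<Rightarrow> nat \<Rightarrow> 'b::field vec set" where
  "P_point t l = proj_point (unit_vec t l)"

definition Q_point :: "'b::field \<Rightarrow> nat \<Rightarrow> nat \<Rightarrow> nat \<Rightarrow> nat \<Rightarrow> 'b vec set" where
  "Q_point \<gamma> t l m i = proj_point (unit_vec t l + \<gamma> ^ i \<cdot>\<^sub>v unit_vec t m)"

definition D_planes ::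
    "'b::field \<Rightarrow> ('b \<Rightarrow> 'a::field mat) \<Rightarrow> nat \<Rightarrow> (nat \<Rightarrow> nat \<Rightarrow> nat) \<Rightarrow> (nat \<Rightarrow> nat \<Rightarrow> nat)
      \<Rightarrow> 'a vec set set" where
  "D_planes \<gamma> \<phi> t i j = field_reduction \<phi> t `
     ({P_point t l | l. l < t} \<union>
      {Q_point \<gamma> t l m (i l m) | l m. l < m \<and> m < t} \<union>
      {Q_point \<gamma> t l m (j l m) | l m. l < m \<and> m < t})"

text \<open>
  The columns of \<open>G\<close> are vector representatives of the points in \<open>X\<close>, one for each point.
\<close>

definition columns_represent :: "nat \<Rightarrow> nat \<Rightarrow> 'a::field mat \<Rightarrow> 'a vec set set \<Rightarrow> bool" where
  "columns_represent k n G X \<longleftrightarrow>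
     G \<in> carrier_mat k n \<and> bij_betw (\<lambda>c. proj_point (col G c)) {..<n} X"

end

theory Submission
  imports Defs "Jordan_Normal_Form.Char_Poly"
begin

text \<open>
  A codeword is the list of values of a functional \<open>a\<close> of \<open>F_q^k\<close> at the chosen points, so its weight
  counts the points off the hyperplane of \<open>a\<close>, and minimality says that the points on this hyperplane
  determine \<open>a\<close> up to a scalar.

  A line of a plane \<open>\<pi>\<close> meets a Baer subplane in \<open>1\<close> or \<open>sqrt q + 1\<close> points. Two disjoint Baer
  subplanes of \<open>\<pi>\<close> therefore determine the restriction of \<open>a\<close> to \<open>\<pi>\<close> up to a scalar, and at least
  \<open>2 q\<close> of their points are off the hyperplane whenever that restriction is nonzero.

  Through \<open>\<phi>\<close>, the space \<open>F_q^3\<close> is a one-dimensional vector space over \<open>F_(q^3)\<close>. If \<open>a_l \<in> F_q^3\<close> are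
  the blocks of \<open>a\<close>, the restriction of \<open>a\<close> to the plane of \<open>[v]\<close> is represented by
  \<open>\<Sum>l. v_l a_l\<close>. If \<open>b\<close> is proportional to \<open>a\<close> over \<open>F_q\<close> on every plane, then \<open>b_l = c_l a_l\<close> for all \<open>l\<close>,
  and \<open>c_l \<noteq> c_m\<close> would force both \<open>a_l / (\<gamma>^i a_m)\<close> and \<open>a_l / (\<gamma>^j a_m)\<close> into \<open>F_q\<close>, hence
  \<open>\<gamma>^(j - i) \<in> F_q\<close>, contrary to the choice of \<open>i\<close> and \<open>j\<close>. For the distance, at least
  \<open>2 t - 1\<close> of the \<open>t^2\<close> restrictions of a nonzero \<open>a\<close> are nonzero.
\<close>

subsection \<open>Subspaces over a finite field\<close>

text \<open>A finite carrier spans itself, so there is a finite basis, and coordinates with respect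
  to it match vectors with scalar functions on the basis.\<close>

lemma (in vectorspace) card_carrier_eq_power_dim:
  assumes "finite (carrier V)"
  shows "card (carrier V) = card (carrier K) ^ dim"
proof -
  have "gen_set (carrier V)"
    using in_own_span span_is_subset2 by blast
  then have "fin_dim"
    using assms unfolding fin_dim_def by blast
  then obtain \<beta> where \<beta>: "finite \<beta>" "basis \<beta>"
    using finite_basis_exists by blast
  have sub: "\<beta> \<subseteq> carrier V"
    using \<beta>(2) unfolding basis_def by blast
  have uniq: "\<exists>!a. a \<in> \<beta> \<rightarrow>\<^sub>E carrier K \<and> lincomb a \<beta> = v" if "v \<in> carrier V" for v
    using basis_criterion[OF \<beta>(1) sub] \<beta>(2) that by blast
  have closed: "lincomb a \<beta> \<in> carrier V" if "a \<in> \<beta> \<rightarrow>\<^sub>E carrier K" for a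
    using lincomb_closed[OF sub] that by auto
  have "bij_betw (\<lambda>a. lincomb a \<beta>) (\<beta> \<rightarrow>\<^sub>E carrier K) (carrier V)"
  proof (rule bij_betw_imageI)
    show "inj_on (\<lambda>a. lincomb a \<beta>) (\<beta> \<rightarrow>\<^sub>E carrier K)"
      using uniq closed unfolding inj_on_def by metis
    show "(\<lambda>a. lincomb a \<beta>) ` (\<beta> \<rightarrow>\<^sub>E carrier K) = carrier V"
      using ex1_implies_ex[OF uniq] closed unfolding image_iff by (intro equalityI subsetI) blast+
  qed
  then have "card (carrier V) = card (\<beta> \<rightarrow>\<^sub>E carrier K)"
    by (simp add: bij_betw_same_card)
  then show ?thesis
    using \<beta> by (simp add: card_PiE dim_basis)
qed

lemma finite_carrier_vec [simp]: "finite (carrier_vec n :: 'a::finite vec set)"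
  and card_carrier_vec: "card (carrier_vec n :: 'a::finite vec set) = CARD('a) ^ n"
proof -
  let ?L = "{xs :: 'a list. set xs \<subseteq> UNIV \<and> length xs = n}"
  have eq: "carrier_vec n = vec_of_list ` ?L"
  proof (intro equalityI subsetI)
    fix v :: "'a vec"
    assume "v \<in> carrier_vec n"
    then have "v = vec_of_list (list_of_vec v)" "length (list_of_vec v) = n"
      by (simp_all add: vec_list)
    then show "v \<in> vec_of_list ` ?L"
      by blast
  qed (auto intro: carrier_vecI)
  have inj: "inj_on vec_of_list ?L"
    by (metis (no_types, lifting) inj_onI list_vec)
  show "finite (carrier_vec n :: 'a vec set)"
    unfolding eq by (rule finite_imageI[OF finite_lists_length_eq]) simp
  show "card (carrier_vec n :: 'a vec set) = CARD('a) ^ n"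
    unfolding eq card_image[OF inj] by (rule card_lists_length_eq) simp
qed

lemma card_field_ge_2: "CARD('a::{finite,field}) \<ge> 2"
proof -
  have "card {0, 1::'a} \<le> CARD('a)"
    by (rule card_mono) auto
  then show ?thesis
    by simp
qed

lemma subspace_module_vec_iff:
  "VectorSpace.subspace class_ring W (module_vec TYPE('a::field) n) \<longleftrightarrow>
     W \<subseteq> carrier_vec n \<and> 0\<^sub>v n \<in> W \<and> (\<forall>x\<in>W. \<forall>y\<in>W. x + y \<in> W) \<and> (\<forall>a. \<forall>x\<in>W. a \<cdot>\<^sub>v x \<in> W)"
proof -
  have "Module.module class_ring (module_vec TYPE('a) n)"
    using vec_vs[where 'a='a] unfolding vectorspace_def by blast
  then show ?thesis
    using vec_vs[where 'a='a and n=n]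
    by (auto simp: VectorSpace.subspace_def submodule_def module_vec_simps)
qed

text \<open>Over a finite field \<open>CARD('a) ^ r\<close> determines \<open>r\<close>, so
  dimension can be replaced by cardinality. All later dimension arguments are therefore
  counts.\<close>

lemma subspaces_of_dim_iff:
  "W \<in> subspaces_of_dim n r \<longleftrightarrow>
     W \<subseteq> carrier_vec n \<and> 0\<^sub>v n \<in> W \<and> (\<forall>x\<in>W. \<forall>y\<in>W. x + y \<in> W) \<and> (\<forall>a. \<forall>x\<in>W. a \<cdot>\<^sub>v x \<in> W) \<and>
     card W = CARD('a) ^ r"
  for W :: "'a::{finite,field} vec set"
proof -
  have "card W = CARD('a) ^ r \<longleftrightarrow>
      vectorspace.dim class_ring ((module_vec TYPE('a) n)\<lparr>carrier := W\<rparr>) = r"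
    if W: "VectorSpace.subspace class_ring W (module_vec TYPE('a) n)"
  proof -
    interpret V: vectorspace class_ring "module_vec TYPE('a) n"
      by (rule vec_vs)
    interpret W: vectorspace class_ring "(module_vec TYPE('a) n)\<lparr>carrier := W\<rparr>"
      by (rule V.subspace_is_vs[OF W])
    have "finite W"
      using W finite_subset[OF _ finite_carrier_vec] unfolding subspace_module_vec_iff by blast
    then have "card W = CARD('a) ^ W.dim"
      using W.card_carrier_eq_power_dim by simp
    then show ?thesis
      using card_field_ge_2[where 'a='a] by (simp add: power_inject_exp)
  qed
  then show ?thesis
    unfolding subspaces_of_dim_def using subspace_module_vec_iff[of W n] by auto
qed

lemma
  fixes W :: "'a::{finite,field} vec set"
  assumes "W \<in> subspaces_of_dim n r"
  shows subspaces_of_dim_carrier: "W \<subseteq> carrier_vec n"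
    and subspaces_of_dim_zero: "0\<^sub>v n \<in> W"
    and subspaces_of_dim_add: "\<And>x y. x \<in> W \<Longrightarrow> y \<in> W \<Longrightarrow> x + y \<in> W"
    and subspaces_of_dim_smult: "\<And>a x. x \<in> W \<Longrightarrow> a \<cdot>\<^sub>v x \<in> W"
    and subspaces_of_dim_card: "card W = CARD('a) ^ r"
    and subspaces_of_dim_finite: "finite W"
  using assms finite_subset[OF _ finite_carrier_vec, of W n] by (auto simp: subspaces_of_dim_iff)

lemma carrier_vec_in_subspaces_of_dim:
  "(carrier_vec n :: 'a::{finite,field} vec set) \<in> subspaces_of_dim n n"
  by (auto simp: subspaces_of_dim_iff card_carrier_vec)

subsection \<open>Points\<close>

lemma proj_point_eq:
  fixes v :: "'a::field vec"
  shows "proj_point v = range (\<lambda>a. a \<cdot>\<^sub>v v)"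
proof -
  interpret vec_space "TYPE('a)" "dim_vec v" .
  have v: "v \<in> carrier_vec (dim_vec v)"
    by simp
  have "proj_point v = {lincomb a {v} |a. a \<in> {v} \<rightarrow> carrier class_ring}"
    unfolding proj_point_def by (subst finite_span) auto
  also have "\<dots> = {a v \<cdot>\<^sub>v v | a. True}"
    by (auto simp: lincomb_def)
  also have "\<dots> = range (\<lambda>a. a \<cdot>\<^sub>v v)"
    by (auto simp: image_iff)
  finally show ?thesis .
qed

lemma smult_eq_zero_vec_iff:
  fixes v :: "'a::field vec"
  assumes "v \<in> carrier_vec n"
  shows "a \<cdot>\<^sub>v v = 0\<^sub>v n \<longleftrightarrow> a = 0 \<or> v = 0\<^sub>v n"
proof
  assume eq: "a \<cdot>\<^sub>v v = 0\<^sub>v n"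
  have "v = 0\<^sub>v n" if "a \<noteq> 0"
  proof (rule eq_vecI)
    fix i assume "i < dim_vec (0\<^sub>v n :: 'a vec)"
    with eq assms have "(a \<cdot>\<^sub>v v) $ i = 0"
      by simp
    with \<open>i < _\<close> assms that show "v $ i = 0\<^sub>v n $ i"
      by simp
  qed (use assms in simp)
  then show "a = 0 \<or> v = 0\<^sub>v n"
    by blast
next
  assume "a = 0 \<or> v = 0\<^sub>v n"
  then show "a \<cdot>\<^sub>v v = 0\<^sub>v n"
    using assms by (intro eq_vecI) auto
qed

lemma smult_right_cancel_vec:
  fixes v :: "'a::field vec"
  assumes "v \<in> carrier_vec n" "v \<noteq> 0\<^sub>v n"
  shows "a \<cdot>\<^sub>v v = b \<cdot>\<^sub>v v \<longleftrightarrow> a = b"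
proof
  assume eq: "a \<cdot>\<^sub>v v = b \<cdot>\<^sub>v v"
  have "(a - b) \<cdot>\<^sub>v v = 0\<^sub>v n"
  proof (rule eq_vecI)
    fix i assume "i < dim_vec (0\<^sub>v n :: 'a vec)"
    with arg_cong[OF eq, of "\<lambda>w. w $ i"] assms show "((a - b) \<cdot>\<^sub>v v) $ i = 0\<^sub>v n $ i"
      by (simp add: left_diff_distrib)
  qed (use assms in simp)
  then show "a = b"
    using smult_eq_zero_vec_iff[OF assms(1)] assms(2) by auto
qed simp

lemma self_in_proj_point: "(v :: 'a::field vec) \<in> proj_point v"
  unfolding proj_point_eq by (metis one_smult_vec rangeI)

lemma proj_point_in_subspaces:
  fixes v :: "'a::{finite,field} vec"
  assumes "v \<in> carrier_vec n" "v \<noteq> 0\<^sub>v n"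
  shows "proj_point v \<in> subspaces_of_dim n 1"
proof -
  have "inj (\<lambda>a. a \<cdot>\<^sub>v v)"
    by (rule injI) (simp add: smult_right_cancel_vec[OF assms])
  then have "card (proj_point v) = CARD('a)"
    unfolding proj_point_eq by (rule card_image)
  moreover have "0\<^sub>v n \<in> proj_point v"
    unfolding proj_point_eq using smult_eq_zero_vec_iff[OF assms(1), of 0] by (metis rangeI)
  moreover have "x + y \<in> proj_point v" if "x \<in> proj_point v" "y \<in> proj_point v" for x y
    using that unfolding proj_point_eq by (auto simp: add_smult_distrib_vec[symmetric])
  moreover have "a \<cdot>\<^sub>v x \<in> proj_point v" if "x \<in> proj_point v" for a x
    using that unfolding proj_point_eq by (auto simp: smult_smult_assoc)
  moreover have "proj_point v \<subseteq> carrier_vec n"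
    using assms by (auto simp: proj_point_eq)
  ultimately show ?thesis
    unfolding subspaces_of_dim_iff by auto
qed

text \<open>The multiples of \<open>v\<close> already exhaust the \<open>CARD('a)\<close> elements
  of \<open>P\<close>.\<close>

lemma point_eq_proj_point:
  fixes P :: "'a::{finite,field} vec set"
  assumes P: "P \<in> subspaces_of_dim n 1" and v: "v \<in> P" "v \<noteq> 0\<^sub>v n"
  shows "P = proj_point v"
proof -
  have vc: "v \<in> carrier_vec n"
    using subspaces_of_dim_carrier[OF P] v by blast
  have "proj_point v \<subseteq> P"
    using subspaces_of_dim_smult[OF P v(1)] unfolding proj_point_eq by blast
  moreover have "card (proj_point v) = card P"
    using proj_point_in_subspaces[OF vc v(2)] P by (simp add: subspaces_of_dim_card)
  ultimately show ?thesis
    using subspaces_of_dim_finite[OF P] by (metis card_subset_eq)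
qed

lemma subspace_nonzero_vector:
  fixes W :: "'a::{finite,field} vec set"
  assumes W: "W \<in> subspaces_of_dim n r" and "r \<ge> 1"
  obtains v where "v \<in> W" "v \<noteq> 0\<^sub>v n"
proof -
  have "CARD('a) ^ 1 \<le> CARD('a) ^ r"
    using assms card_field_ge_2[where 'a='a] by (intro power_increasing) auto
  then have "card W \<ge> 2"
    using subspaces_of_dim_card[OF W] card_field_ge_2[where 'a='a] by simp
  then have "\<not> W \<subseteq> {0\<^sub>v n}"
    using card_mono[of "{0\<^sub>v n}" W] by auto
  then show ?thesis
    using that by blast
qed

lemma points_eq_if_common_vector:
  fixes P Q :: "'a::{finite,field} vec set"
  assumes "P \<in> subspaces_of_dim n 1" "Q \<in> subspaces_of_dim n 1" "v \<in> P" "v \<in> Q" "v \<noteq> 0\<^sub>v n"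
  shows "P = Q"
  using assms point_eq_proj_point by metis

text \<open>The points of \<open>W\<close> partition its nonzero vectors into classes of size
  \<open>CARD('a) - 1\<close>. The product form avoids division.\<close>

lemma card_points_in:
  fixes W :: "'a::{finite,field} vec set"
  assumes W: "W \<in> subspaces_of_dim n r"
  shows "card (points_in n W) * (CARD('a) - 1) = CARD('a) ^ r - 1"
proof -
  have P: "P \<in> subspaces_of_dim n 1" "P \<subseteq> W" if "P \<in> points_in n W" for P
    using that unfolding points_in_def by auto
  have fin: "finite (points_in n W)"
    by (rule finite_subset[of _ "Pow W"]) (auto simp: points_in_def subspaces_of_dim_finite[OF W])
  have "W - {0\<^sub>v n} = (\<Union>P\<in>points_in n W. P - {0\<^sub>v n})"
  proof (intro equalityI subsetI)
    fix v assume v: "v \<in> W - {0\<^sub>v n}"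
    then have vc: "v \<in> carrier_vec n"
      using subspaces_of_dim_carrier[OF W] by blast
    have "proj_point v \<subseteq> W"
      using v subspaces_of_dim_smult[OF W] unfolding proj_point_eq by blast
    then have "proj_point v \<in> points_in n W"
      using v vc proj_point_in_subspaces unfolding points_in_def by blast
    then show "v \<in> (\<Union>P\<in>points_in n W. P - {0\<^sub>v n})"
      using v self_in_proj_point by blast
  qed (use P in blast)
  moreover have "\<forall>P\<in>points_in n W. finite (P - {0\<^sub>v n})"
    using P subspaces_of_dim_finite by blast
  moreover have "\<forall>P\<in>points_in n W. \<forall>Q\<in>points_in n W. P \<noteq> Q \<longrightarrow> (P - {0\<^sub>v n}) \<inter> (Q - {0\<^sub>v n}) = {}"
    using P points_eq_if_common_vector by blast
  ultimately have "card (W - {0\<^sub>v n}) = (\<Sum>P\<in>points_in n W. card (P - {0\<^sub>v n}))"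
    using card_UN_disjoint[OF fin] by (simp only:)
  also have "\<dots> = (\<Sum>P\<in>points_in n W. CARD('a) - 1)"
    using subspaces_of_dim_card[OF P(1)] subspaces_of_dim_zero[OF P(1)]
    by (intro sum.cong) (simp_all add: card_Diff_singleton)
  finally show ?thesis
    using W by (simp add: subspaces_of_dim_card subspaces_of_dim_zero subspaces_of_dim_finite)
qed

lemma card_points_in_line:
  fixes L :: "'a::{finite,field} vec set"
  assumes "L \<in> subspaces_of_dim n 2"
  shows "card (points_in n L) = CARD('a) + 1"
proof -
  \<comment> \<open>Writing q as \<open>m + 2\<close> removes the natural subtractions before
    cancelling q - 1.\<close>
  obtain m where m: "CARD('a) = m + 2"
    using card_field_ge_2[where 'a='a] by (metis le_add_diff_inverse2)
  have "card (points_in n L) * (m + 1) = (m + 3) * (m + 1)"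
    using card_points_in[OF assms] unfolding m by (simp add: power2_eq_square algebra_simps)
  then show ?thesis
    unfolding m mult_cancel2 by simp
qed

lemma card_points_in_plane:
  fixes L :: "'a::{finite,field} vec set"
  assumes "L \<in> subspaces_of_dim n 3"
  shows "card (points_in n L) = CARD('a)\<^sup>2 + CARD('a) + 1"
proof -
  obtain m where m: "CARD('a) = m + 2"
    using card_field_ge_2[where 'a='a] by (metis le_add_diff_inverse2)
  have "card (points_in n L) * (m + 1) = ((m + 2)\<^sup>2 + (m + 2) + 1) * (m + 1)"
    using card_points_in[OF assms] unfolding m by (simp add: power2_eq_square power3_eq_cube algebra_simps)
  then show ?thesis
    unfolding m mult_cancel2 by simp
qed

subsection \<open>Hyperplanes\<close>

definition hyperplane :: "'a::field vec \<Rightarrow> 'a vec set" where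
  "hyperplane a = {x \<in> carrier_vec (dim_vec a). a \<bullet> x = 0}"

lemma in_hyperplane_iff:
  "a \<in> carrier_vec n \<Longrightarrow> x \<in> carrier_vec n \<Longrightarrow> x \<in> hyperplane a \<longleftrightarrow> a \<bullet> x = 0"
  by (auto simp: hyperplane_def)

lemma subset_hyperplane_iff:
  "a \<in> carrier_vec n \<Longrightarrow> W \<subseteq> carrier_vec n \<Longrightarrow> W \<subseteq> hyperplane a \<longleftrightarrow> (\<forall>x\<in>W. a \<bullet> x = 0)"
  by (auto simp: hyperplane_def)

text \<open>Fix \<open>y\<close> in \<open>W\<close> with \<open>a \<bullet> y \<noteq> 0\<close>.
  Every vector of \<open>W\<close> is uniquely \<open>x + c \<cdot>\<^sub>v y\<close> with
  \<open>x\<close> in the kernel of \<open>a\<close>, so the kernel is smaller than \<open>W\<close>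
  by a factor q.\<close>

lemma inter_hyperplane_in_subspaces:
  fixes W :: "'a::{finite,field} vec set"
  assumes W: "W \<in> subspaces_of_dim n (Suc r)" and a: "a \<in> carrier_vec n"
    and not_sub: "\<not> W \<subseteq> hyperplane a"
  shows "W \<inter> hyperplane a \<in> subspaces_of_dim n r"
proof -
  note Wc = subsetD[OF subspaces_of_dim_carrier[OF W]]
  obtain y where y: "y \<in> W" "a \<bullet> y \<noteq> 0"
    using not_sub subset_hyperplane_iff[OF a subspaces_of_dim_carrier[OF W]] by blast
  let ?K = "{x \<in> W. a \<bullet> x = 0}"
  have eq: "W \<inter> hyperplane a = ?K"
    using a Wc by (auto simp: hyperplane_def)
  let ?f = "\<lambda>(x, c). x + c \<cdot>\<^sub>v y"
  have val: "a \<bullet> (x + c \<cdot>\<^sub>v y) = a \<bullet> x + c * (a \<bullet> y)" if "x \<in> W" for x c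
    using a Wc[OF that] Wc[OF y(1)] by (simp add: scalar_prod_add_distrib[of _ n])
  have "bij_betw ?f (?K \<times> UNIV) W"
  proof (rule bij_betw_imageI)
    show "inj_on ?f (?K \<times> UNIV)"
    proof (rule inj_onI, clarify)
      fix x c x' c'
      assume xs: "x \<in> W" "a \<bullet> x = 0" "x' \<in> W" "a \<bullet> x' = 0"
        and e: "x + c \<cdot>\<^sub>v y = x' + c' \<cdot>\<^sub>v y"
      have "a \<bullet> (x + c \<cdot>\<^sub>v y) = a \<bullet> (x' + c' \<cdot>\<^sub>v y)"
        by (simp only: e)
      then have c: "c = c'"
        using xs y by (simp add: val)
      have "x $ i = x' $ i" if "i < n" for i
        using arg_cong[OF e, of "\<lambda>v. v $ i"] that c Wc[OF xs(1)] Wc[OF xs(3)] Wc[OF y(1)] by simp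
      then have "x = x'"
        using Wc[OF xs(1)] Wc[OF xs(3)] by (intro eq_vecI) auto
      with c show "x = x' \<and> c = c'" by simp
    qed
    show "?f ` (?K \<times> UNIV) = W"
    proof (intro equalityI subsetI)
      fix x assume x: "x \<in> W"
      define c where "c = a \<bullet> x / (a \<bullet> y)"
      have "x + (- c) \<cdot>\<^sub>v y \<in> ?K"
        using x y W val[OF x, of "- c"]
        by (simp add: c_def subspaces_of_dim_add subspaces_of_dim_smult)
      moreover have "x = ?f (x + (- c) \<cdot>\<^sub>v y, c)"
        using Wc[OF x] Wc[OF y(1)] by (intro eq_vecI) auto
      ultimately show "x \<in> ?f ` (?K \<times> UNIV)"
        by blast
    qed (use y W in \<open>auto simp: subspaces_of_dim_add subspaces_of_dim_smult\<close>)
  qed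
  then have "card ?K * CARD('a) = CARD('a) ^ Suc r"
    using bij_betw_same_card subspaces_of_dim_card[OF W] by (fastforce simp: card_cartesian_product)
  then have "card ?K = CARD('a) ^ r"
    by simp
  moreover have "0\<^sub>v n \<in> ?K"
    using a W by (simp add: subspaces_of_dim_zero)
  moreover have "x + z \<in> ?K" if "x \<in> ?K" "z \<in> ?K" for x z
    using that a W Wc[of x] Wc[of z]
    by (simp add: scalar_prod_add_distrib[of _ n] subspaces_of_dim_add)
  moreover have "c \<cdot>\<^sub>v x \<in> ?K" if "x \<in> ?K" for c x
    using that a W Wc[of x] by (simp add: subspaces_of_dim_smult)
  ultimately show ?thesis
    unfolding eq subspaces_of_dim_iff using Wc by auto
qed

lemma nonzero_functional_on_subspace:
  fixes L :: "'a::{finite,field} vec set"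
  assumes "L \<in> subspaces_of_dim n r" "r \<ge> 1"
  obtains g where "g \<in> carrier_vec n" "\<not> L \<subseteq> hyperplane g"
proof -
  obtain v where v: "v \<in> L" "v \<noteq> 0\<^sub>v n"
    using subspace_nonzero_vector assms by blast
  have vc: "v \<in> carrier_vec n"
    using v subspaces_of_dim_carrier[OF assms(1)] by blast
  obtain i where i: "i < n" "v $ i \<noteq> 0"
    using v(2) vc by (metis carrier_vecD eq_vecI index_zero_vec)
  have "v \<notin> hyperplane (unit_vec n i)"
    using i vc by (simp add: hyperplane_def)
  then show ?thesis
    using that[of "unit_vec n i"] v by auto
qed

text \<open>Pigeonhole: the q^4 pairs in \<open>L \<times> M\<close> have at most q^3 sums. Two
  pairs with equal sum give a nonzero difference that lies in both lines.\<close>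

lemma lines_meet:
  fixes L M :: "'a::{finite,field} vec set"
  assumes L: "L \<in> subspaces_of_dim 3 2" and M: "M \<in> subspaces_of_dim 3 2"
  shows "points_in 3 L \<inter> points_in 3 M \<noteq> {}"
proof -
  note Lc = subsetD[OF subspaces_of_dim_carrier[OF L]] and Mc = subsetD[OF subspaces_of_dim_carrier[OF M]]
  let ?f = "\<lambda>(x :: 'a vec, y). x + y"
  have "?f ` (L \<times> M) \<subseteq> carrier_vec 3"
    using Lc Mc by auto
  then have "card (?f ` (L \<times> M)) \<le> CARD('a) ^ 3"
    by (metis card_carrier_vec card_mono finite_carrier_vec)
  also have "\<dots> < CARD('a) ^ 4"
    using card_field_ge_2[where 'a='a] by (intro power_strict_increasing) auto
  also have "\<dots> = card (L \<times> M)"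
    using L M by (simp add: card_cartesian_product subspaces_of_dim_card flip: power_add)
  finally have "\<not> inj_on ?f (L \<times> M)"
    using card_image by fastforce
  then obtain x y x' y' where xy: "x \<in> L" "x' \<in> L" "y \<in> M" "y' \<in> M" "x + y = x' + y'" "(x, y) \<noteq> (x', y')"
    unfolding inj_on_def by auto
  have coord: "x $ i + y $ i = x' $ i + y' $ i" if "i < 3" for i
    using arg_cong[OF xy(5), of "\<lambda>v. v $ i"] that Lc[OF xy(1)] Lc[OF xy(2)] Mc[OF xy(3)] Mc[OF xy(4)]
    by simp
  define z where "z = x + (- 1) \<cdot>\<^sub>v x'"
  have zL: "z \<in> L"
    unfolding z_def using L xy by (simp add: subspaces_of_dim_add subspaces_of_dim_smult)
  have zc: "z \<in> carrier_vec 3"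
    using Lc zL by blast
  have "z = y' + (- 1) \<cdot>\<^sub>v y"
    unfolding z_def using coord Lc[OF xy(1)] Lc[OF xy(2)] Mc[OF xy(3)] Mc[OF xy(4)]
    by (intro eq_vecI) (auto simp: algebra_simps eq_diff_eq diff_eq_eq)
  then have zM: "z \<in> M"
    using M xy by (simp add: subspaces_of_dim_add subspaces_of_dim_smult)
  have z0: "z \<noteq> 0\<^sub>v 3"
  proof
    assume z: "z = 0\<^sub>v 3"
    have "x $ i = x' $ i" if "i < 3" for i
      using arg_cong[OF z, of "\<lambda>v. v $ i"] that Lc[OF xy(1)] Lc[OF xy(2)] by (simp add: z_def)
    then have x: "x = x'"
      using Lc[OF xy(1)] Lc[OF xy(2)] by (intro eq_vecI) auto
    then have "y = y'"
      using coord Mc[OF xy(3)] Mc[OF xy(4)] by (intro eq_vecI) auto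
    with x xy(6) show False by simp
  qed
  have "proj_point z \<in> points_in 3 L \<inter> points_in 3 M"
    using proj_point_in_subspaces[OF zc z0] L M zL zM subspaces_of_dim_smult
    unfolding points_in_def proj_point_eq by blast
  then show ?thesis by blast
qed

subsection \<open>Baer subplanes\<close>

context
  fixes n :: nat and \<pi> :: "'a::{finite,field} vec set" and B :: "'a vec set set"
  assumes baer: "baer_subplane TYPE('c::{finite,field}) n \<pi> B"
    and plane: "\<pi> \<in> subspaces_of_dim n 3"
begin

lemma baer_card_field: "CARD('c)\<^sup>2 = CARD('a)"
  using baer unfolding baer_subplane_def by blast

lemma baer_point:
  assumes "P \<in> B"
  shows "P \<in> subspaces_of_dim n 1" "P \<subseteq> \<pi>"
  using baer assms unfolding baer_subplane_def points_in_def by auto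

lemma finite_baer: "finite B"
  by (rule finite_subset[of _ "Pow \<pi>"]) (use baer_point subspaces_of_dim_finite[OF plane] in auto)

text \<open>The isomorphism is in particular a bijection from all points of PG(2,
  \<open>'c\<close>).\<close>

lemma card_baer: "card B = CARD('c)\<^sup>2 + CARD('c) + 1"
proof -
  obtain f where "bij_betw f (subspaces_of_dim 3 1 :: 'c vec set set) B"
    using baer unfolding baer_subplane_def by (elim conjE exE)
  moreover have "(subspaces_of_dim 3 1 :: 'c vec set set) = points_in 3 (carrier_vec 3)"
    using subspaces_of_dim_carrier unfolding points_in_def by auto
  ultimately show ?thesis
    using card_points_in_plane[OF carrier_vec_in_subspaces_of_dim[of 3, where 'a='c]]
    by (metis bij_betw_same_card)
qed

text \<open>The isomorphism turns each secant section into a line of PG(2, \<open>'c\<close>), where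
  any two lines meet and each line has \<open>CARD('c) + 1\<close> points.\<close>

lemma baer_secants_meet:
  assumes L: "L \<in> subspaces_of_dim n 2" "L \<subseteq> \<pi>" "card {P \<in> B. P \<subseteq> L} \<ge> 2"
    and M: "M \<in> subspaces_of_dim n 2" "M \<subseteq> \<pi>" "card {P \<in> B. P \<subseteq> M} \<ge> 2"
  shows "{P \<in> B. P \<subseteq> L} \<inter> {P \<in> B. P \<subseteq> M} \<noteq> {}"
    and "card {P \<in> B. P \<subseteq> L} = CARD('c) + 1"
proof -
  obtain f where f: "bij_betw f (subspaces_of_dim 3 1 :: 'c vec set set) B"
    and lines: "(\<lambda>L. f ` points_in 3 L) ` (subspaces_of_dim 3 2 :: 'c vec set set) =
      {points_in n L \<inter> B | L. L \<in> subspaces_of_dim n 2 \<and> L \<subseteq> \<pi> \<and> card (points_in n L \<inter> B) \<ge> 2}"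
    using baer unfolding baer_subplane_def by (elim conjE exE)
  have eq: "points_in n K \<inter> B = {P \<in> B. P \<subseteq> K}" for K
    using baer_point unfolding points_in_def by blast
  have "\<exists>l \<in> subspaces_of_dim 3 2. {P \<in> B. P \<subseteq> K} = f ` points_in 3 (l :: 'c vec set)"
    if "K \<in> subspaces_of_dim n 2" "K \<subseteq> \<pi>" "card {P \<in> B. P \<subseteq> K} \<ge> 2" for K
  proof -
    have "{P \<in> B. P \<subseteq> K} \<in> (\<lambda>L. f ` points_in 3 L) ` (subspaces_of_dim 3 2 :: 'c vec set set)"
      unfolding lines mem_Collect_eq eq using that by (intro exI[of _ K] conjI) simp_all
    then show ?thesis
      by (elim imageE) (rule bexI)
  qed
  note ex = this
  obtain l :: "'c vec set" where l: "l \<in> subspaces_of_dim 3 2" "{P \<in> B. P \<subseteq> L} = f ` points_in 3 l"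
    using ex[OF L] by (elim bexE)
  obtain m :: "'c vec set" where m: "m \<in> subspaces_of_dim 3 2" "{P \<in> B. P \<subseteq> M} = f ` points_in 3 m"
    using ex[OF M] by (elim bexE)
  show "{P \<in> B. P \<subseteq> L} \<inter> {P \<in> B. P \<subseteq> M} \<noteq> {}"
    using lines_meet[OF l(1) m(1)] unfolding l m by blast
  have "inj_on f (points_in 3 l)"
    using f by (auto simp: bij_betw_def points_in_def intro: inj_on_subset)
  then show "card {P \<in> B. P \<subseteq> L} = CARD('c) + 1"
    unfolding l using card_points_in_line[OF l(1)] by (simp add: card_image)
qed

lemma baer_line_le:
  assumes "L \<in> subspaces_of_dim n 2" "L \<subseteq> \<pi>"
  shows "card {P \<in> B. P \<subseteq> L} \<le> CARD('c) + 1"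
  using baer_secants_meet(2)[OF assms _ assms] by (cases "card {P \<in> B. P \<subseteq> L} \<ge> 2") auto

text \<open>
  If the line cut out by \<open>a\<close> misses \<open>B\<close>, pick a functional \<open>g\<close> that is nonzero on this line.
  The ratio \<open>g / a\<close> maps \<open>B\<close> to the field, and its fibres lie on lines of the plane. As two
  secants meet in \<open>B\<close>, at most one fibre has more than one point, so \<open>B\<close> would have at most
  \<open>CARD('c) + CARD('a)\<close> points.
\<close>

lemma baer_blocking:
  assumes a: "a \<in> carrier_vec n" "\<not> \<pi> \<subseteq> hyperplane a"
  shows "\<exists>P\<in>B. P \<subseteq> hyperplane a"
proof (rule ccontr)
  assume none: "\<not> (\<exists>P\<in>B. P \<subseteq> hyperplane a)"
  have "\<pi> \<inter> hyperplane a \<in> subspaces_of_dim n 2"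
    using inter_hyperplane_in_subspaces[OF _ a, of 2] plane by simp
  then obtain g where g: "g \<in> carrier_vec n" "\<not> \<pi> \<inter> hyperplane a \<subseteq> hyperplane g"
    using nonzero_functional_on_subspace by (metis one_le_numeral)
  note pic = subsetD[OF subspaces_of_dim_carrier[OF plane]]
  \<comment> \<open>Off the line \<open>a = 0\<close>, the zeros of \<open>h c\<close> are the
    points where the ratio \<open>g / a\<close> equals \<open>c\<close>.\<close>
  define h where "h c = g + (- c) \<cdot>\<^sub>v a" for c
  have hc: "h c \<in> carrier_vec n" for c
    using a g by (simp add: h_def)
  have h_val: "h c \<bullet> x = g \<bullet> x - c * (a \<bullet> x)" if "x \<in> \<pi>" for c x
    using a g pic[OF that] by (simp add: h_def add_scalar_prod_distrib[of _ n])
  obtain y where y: "y \<in> \<pi>" "a \<bullet> y = 0" "g \<bullet> y \<noteq> 0"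
    using g a pic by (auto simp: hyperplane_def)
  \<comment> \<open>On the line \<open>a = 0\<close> every \<open>h c\<close> agrees with
    \<open>g\<close>, which is nonzero at \<open>y\<close>; hence each fibre lies on a proper line
    of the plane.\<close>
  have "\<not> \<pi> \<subseteq> hyperplane (h c)" for c
    using y h_val[OF y(1), of c] by (auto simp: hyperplane_def)
  then have line: "\<pi> \<inter> hyperplane (h c) \<in> subspaces_of_dim n 2" for c
    using inter_hyperplane_in_subspaces[OF _ hc, of \<pi> 2] plane by simp
  define F where "F c = {P \<in> B. P \<subseteq> \<pi> \<inter> hyperplane (h c)}" for c
  \<comment> \<open>A point in two fibres would have \<open>a = 0\<close> on it, but no point of
    \<open>B\<close> lies on that line.\<close>
  have disj: "F c \<inter> F d = {}" if "c \<noteq> d" for c d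
  proof (rule ccontr)
    assume "F c \<inter> F d \<noteq> {}"
    then obtain P where P: "P \<in> B" "P \<subseteq> \<pi>" "P \<subseteq> hyperplane (h c)" "P \<subseteq> hyperplane (h d)"
      unfolding F_def by blast
    have "a \<bullet> x = 0" if "x \<in> P" for x
    proof -
      have x: "x \<in> \<pi>" "h c \<bullet> x = 0" "h d \<bullet> x = 0"
        using P(2-4) that unfolding hyperplane_def by blast+
      then have "c * (a \<bullet> x) = d * (a \<bullet> x)"
        using h_val[OF x(1), of c] h_val[OF x(1), of d] by simp
      with \<open>c \<noteq> d\<close> show ?thesis by simp
    qed
    then have "P \<subseteq> hyperplane a"
      using P(2) a pic by (auto simp: hyperplane_def)
    then show False
      using none P(1) by blast
  qed
  have cover: "B \<subseteq> (\<Union>c. F c)"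
  proof
    fix P assume P: "P \<in> B"
    have "P \<subseteq> carrier_vec n"
      using baer_point(2)[OF P] pic by blast
    then obtain x where x: "x \<in> P" "a \<bullet> x \<noteq> 0"
      using none P subset_hyperplane_iff[OF a(1)] by meson
    then have x\<pi>: "x \<in> \<pi>" and x0: "x \<noteq> 0\<^sub>v n"
      using baer_point[OF P] a by auto
    have "P = proj_point x"
      using point_eq_proj_point[OF _ x(1) x0] baer_point[OF P] by blast
    moreover have "x \<in> hyperplane (h (g \<bullet> x / (a \<bullet> x)))"
      using x h_val[OF x\<pi>] in_hyperplane_iff[OF hc pic[OF x\<pi>]] by simp
    ultimately have "P \<subseteq> hyperplane (h (g \<bullet> x / (a \<bullet> x)))"
      using hc[of "g \<bullet> x / (a \<bullet> x)"] pic[OF x\<pi>]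
      by (auto simp: proj_point_eq in_hyperplane_iff[of _ n])
    then show "P \<in> (\<Union>c. F c)"
      using P baer_point[OF P] unfolding F_def by blast
  qed
  have finF: "finite (F c)" for c
    using finite_baer unfolding F_def by simp
  have two: "c = d" if "card (F c) \<ge> 2" "card (F d) \<ge> 2" for c d
    using disj[of c d] baer_secants_meet(1)[OF line[of c] _ that(1)[unfolded F_def]
        line[of d] _ that(2)[unfolded F_def]]
    unfolding F_def by blast
  \<comment> \<open>\<open>c0\<close> is the value of the only fibre that can be large. If all
    fibres are small, any value serves.\<close>
  obtain c0 where c0: "card (F c) \<le> 1" if "c \<noteq> c0" for c
  proof (cases "\<exists>c. card (F c) \<ge> 2")
    case True
    then obtain c where "card (F c) \<ge> 2" by blast
    with two have "card (F d) \<le> 1" if "d \<noteq> c" for d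
      using that by (metis not_less_eq_eq numeral_2_eq_2 One_nat_def)
    then show ?thesis
      by (rule that)
  next
    case False
    then have "card (F d) \<le> 1" for d
      by (metis not_less_eq_eq numeral_2_eq_2 One_nat_def)
    then show ?thesis
      by (rule that)
  qed
  have "card B \<le> card (\<Union>c. F c)"
    using cover finF by (intro card_mono) auto
  also have "\<dots> \<le> (\<Sum>c\<in>UNIV. card (F c))"
    by (rule card_UN_le) simp
  also have "\<dots> = card (F c0) + (\<Sum>c\<in>UNIV - {c0}. card (F c))"
    by (rule sum.remove) auto
  also have "(\<Sum>c\<in>UNIV - {c0}. card (F c)) \<le> (\<Sum>c\<in>UNIV - {c0}. 1)"
    using c0 by (intro sum_mono) auto
  also have "\<dots> = CARD('a) - 1"
    by simp
  also have "card (F c0) \<le> CARD('c) + 1"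
    unfolding F_def using baer_line_le[OF line] by simp
  finally have "card B \<le> CARD('c) + 1 + (CARD('a) - 1)"
    by simp
  \<comment> \<open>With s = \<open>CARD('c)\<close> and q = s^2 the bound is s + q, one less than
    the size q + s + 1 of \<open>B\<close>.\<close>
  then show False
    using card_baer baer_card_field card_field_ge_2[where 'a='a] by simp
qed

lemma baer_hyperplane_le:
  assumes "a \<in> carrier_vec n" "\<not> \<pi> \<subseteq> hyperplane a"
  shows "card {P \<in> B. P \<subseteq> hyperplane a} \<le> CARD('c) + 1"
proof -
  have "\<pi> \<inter> hyperplane a \<in> subspaces_of_dim n 2"
    using inter_hyperplane_in_subspaces[OF _ assms, of 2] plane by simp
  then have "card {P \<in> B. P \<subseteq> \<pi> \<inter> hyperplane a} \<le> CARD('c) + 1"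
    by (rule baer_line_le) simp
  moreover have "{P \<in> B. P \<subseteq> \<pi> \<inter> hyperplane a} = {P \<in> B. P \<subseteq> hyperplane a}"
    using baer_point by blast
  ultimately show ?thesis by simp
qed

text \<open>With s = \<open>CARD('c)\<close>, at most s + 1 of the s^2 + s + 1 points are on the
  hyperplane, which leaves s^2 = q.\<close>

lemma baer_off_hyperplane_ge:
  assumes "a \<in> carrier_vec n" "\<not> \<pi> \<subseteq> hyperplane a"
  shows "card {P \<in> B. \<not> P \<subseteq> hyperplane a} \<ge> CARD('a)"
proof -
  have "card B = card {P \<in> B. P \<subseteq> hyperplane a} + card {P \<in> B. \<not> P \<subseteq> hyperplane a}"
    using finite_baer by (subst card_Un_disjoint[symmetric]) (auto intro: arg_cong[where f=card])
  then show ?thesis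
    using baer_hyperplane_le[OF assms] card_baer baer_card_field by simp
qed

end

text \<open>Each Baer subplane has a point on the line \<open>a = 0\<close>, and disjointness makes
  the two points distinct. So \<open>b\<close> vanishes on the whole line, and two functionals on a
  plane with the same kernel line, or the second being zero, are proportional.\<close>

lemma disjoint_baer_subplanes_functional:
  fixes \<pi> :: "'a::{finite,field} vec set"
  assumes B1: "baer_subplane TYPE('c::{finite,field}) n \<pi> B1"
    and B2: "baer_subplane TYPE('c) n \<pi> B2" and disj: "B1 \<inter> B2 = {}"
    and plane: "\<pi> \<in> subspaces_of_dim n 3"
    and a: "a \<in> carrier_vec n" and b: "b \<in> carrier_vec n"
    and ab: "\<And>P. P \<in> B1 \<union> B2 \<Longrightarrow> P \<subseteq> hyperplane a \<Longrightarrow> P \<subseteq> hyperplane b"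
  shows "\<exists>c. \<forall>x\<in>\<pi>. b \<bullet> x = c * (a \<bullet> x)"
proof (cases "\<pi> \<subseteq> hyperplane a")
  case True
  \<comment> \<open>Here \<open>b\<close> vanishes on all of \<open>B1\<close>, which has too many
    points for a single line.\<close>
  have "\<pi> \<subseteq> hyperplane b"
  proof (rule ccontr)
    assume "\<not> \<pi> \<subseteq> hyperplane b"
    then have "card {P \<in> B1. P \<subseteq> hyperplane b} \<le> CARD('c) + 1"
      by (rule baer_hyperplane_le[OF B1 plane b])
    moreover have "{P \<in> B1. P \<subseteq> hyperplane b} = B1"
      using ab True baer_point(2)[OF B1 plane] by blast
    ultimately show False
      using card_baer[OF B1 plane] by simp
  qed
  then show ?thesis
    by (intro exI[of _ 0]) (auto simp: hyperplane_def)
next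
  case False
  note pic = subsetD[OF subspaces_of_dim_carrier[OF plane]]
  define K where "K = \<pi> \<inter> hyperplane a"
  have K: "K \<in> subspaces_of_dim n (Suc 1)"
    unfolding K_def using inter_hyperplane_in_subspaces[OF _ a False, of 2] plane by (simp add: eval_nat_numeral)
  obtain P1 P2 where P: "P1 \<in> B1" "P1 \<subseteq> hyperplane a" "P2 \<in> B2" "P2 \<subseteq> hyperplane a"
    using baer_blocking[OF B1 plane a False] baer_blocking[OF B2 plane a False] by blast
  have Pd: "P1 \<in> subspaces_of_dim n 1" "P1 \<subseteq> \<pi>" "P2 \<in> subspaces_of_dim n 1" "P2 \<subseteq> \<pi>"
    using baer_point[OF B1 plane P(1)] baer_point[OF B2 plane P(3)] by auto
  have "K \<subseteq> hyperplane b"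
  proof (rule ccontr)
    assume "\<not> K \<subseteq> hyperplane b"
    \<comment> \<open>Otherwise \<open>b\<close> would have just one zero on the line
      \<open>K\<close>, so \<open>P1\<close> and \<open>P2\<close> would coincide.\<close>
    then have Kb: "K \<inter> hyperplane b \<in> subspaces_of_dim n 1"
      by (rule inter_hyperplane_in_subspaces[OF K b])
    have "P = K \<inter> hyperplane b" if "P \<subseteq> K \<inter> hyperplane b" "P \<in> subspaces_of_dim n 1" for P
      using that Kb by (intro card_subset_eq) (simp_all add: subspaces_of_dim_finite[OF Kb] subspaces_of_dim_card)
    moreover have "P1 \<subseteq> K \<inter> hyperplane b" "P2 \<subseteq> K \<inter> hyperplane b"
      using P Pd ab unfolding K_def by auto
    ultimately have "P1 = P2"
      using Pd by metis
    then show False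
      using P disj by blast
  qed
  then have bK: "b \<bullet> x = 0" if "x \<in> \<pi>" "a \<bullet> x = 0" for x
    using that a pic[of x] unfolding K_def hyperplane_def by auto
  obtain y where y: "y \<in> \<pi>" "a \<bullet> y \<noteq> 0"
    using False subset_hyperplane_iff[OF a subspaces_of_dim_carrier[OF plane]] by blast
  have "b \<bullet> x = (b \<bullet> y / (a \<bullet> y)) * (a \<bullet> x)" if x: "x \<in> \<pi>" for x
  proof -
    \<comment> \<open>Projection of \<open>x\<close> along \<open>y\<close> to the kernel of
      \<open>a\<close>, where \<open>b\<close> is known to vanish.\<close>
    define z where "z = x + (- (a \<bullet> x / (a \<bullet> y))) \<cdot>\<^sub>v y"
    have z: "z \<in> \<pi>"
      unfolding z_def using plane x y by (simp add: subspaces_of_dim_add subspaces_of_dim_smult)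
    have val: "w \<bullet> z = w \<bullet> x - (a \<bullet> x / (a \<bullet> y)) * (w \<bullet> y)" if "w \<in> carrier_vec n" for w
      unfolding z_def using that pic[OF x] pic[OF y(1)]
      by (simp add: scalar_prod_add_distrib[of _ n])
    have "b \<bullet> z = 0"
      using bK[OF z] val[OF a] y by simp
    then show ?thesis
      using val[OF b] by (simp add: field_simps)
  qed
  then show ?thesis by blast
qed

subsection \<open>Codes from point sets\<close>

lemma proj_point_subset_hyperplane_iff:
  assumes "a \<in> carrier_vec k" "v \<in> carrier_vec k"
  shows "proj_point v \<subseteq> hyperplane a \<longleftrightarrow> a \<bullet> v = 0"
proof
  assume "proj_point v \<subseteq> hyperplane a"
  then show "a \<bullet> v = 0"
    using self_in_proj_point[of v] assms by (auto simp: hyperplane_def)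
qed (use assms in \<open>auto simp: proj_point_eq hyperplane_def\<close>)

lemma weight_zero_vec: "weight (0\<^sub>v n) = 0"
  by (simp add: weight_def support_def)

lemma minus_smult_eq_zero_imp_eq:
  fixes a b :: "'a::field vec"
  assumes "a \<in> carrier_vec k" "b \<in> carrier_vec k" "a + (- 1) \<cdot>\<^sub>v b = 0\<^sub>v k"
  shows "a = b"
proof (rule eq_vecI)
  fix i assume "i < dim_vec b"
  with arg_cong[OF assms(3), of "\<lambda>v. v $ i"] assms(1,2) show "a $ i = b $ i"
    by simp
qed (use assms in simp)

lemma add_minus_one_smult_vec: "v \<in> carrier_vec n \<Longrightarrow> v + (- 1) \<cdot>\<^sub>v v = (0\<^sub>v n :: 'a::field vec)"
  by (intro eq_vecI) auto

context
  fixes k n :: nat and G :: "'a::{finite,field} mat" and X :: "'a vec set set"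
  assumes G: "columns_represent k n G X"
begin

lemma code_gen_carrier: "G \<in> carrier_mat k n"
  using G unfolding columns_represent_def by blast

lemma codeword_nth:
  assumes "a \<in> carrier_vec k" "c < n"
  shows "(G\<^sup>T *\<^sub>v a) $ c = a \<bullet> col G c"
proof -
  have "(G\<^sup>T *\<^sub>v a) $ c = col G c \<bullet> a"
    using assms code_gen_carrier by simp
  also have "\<dots> = a \<bullet> col G c"
    using assms code_gen_carrier by (intro comm_scalar_prod[of _ k]) auto
  finally show ?thesis .
qed

lemma codeword_nth_eq_0_iff:
  assumes "a \<in> carrier_vec k" "c < n"
  shows "(G\<^sup>T *\<^sub>v a) $ c = 0 \<longleftrightarrow> proj_point (col G c) \<subseteq> hyperplane a"
proof -
  have "col G c \<in> carrier_vec k"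
    using code_gen_carrier by auto
  then show ?thesis
    using codeword_nth[OF assms] proj_point_subset_hyperplane_iff[OF assms(1)] by simp
qed

text \<open>A coordinate of the codeword vanishes exactly when the point of its column is on the
  hyperplane of \<open>a\<close>, and the columns match the points of \<open>X\<close> one to
  one.\<close>

lemma weight_codeword:
  assumes a: "a \<in> carrier_vec k"
  shows "weight (G\<^sup>T *\<^sub>v a) = card {P \<in> X. \<not> P \<subseteq> hyperplane a}"
proof -
  have bij: "bij_betw (\<lambda>c. proj_point (col G c)) {..<n} X"
    using G unfolding columns_represent_def by (elim conjE)
  have "support (G\<^sup>T *\<^sub>v a) = {c. c < n \<and> \<not> proj_point (col G c) \<subseteq> hyperplane a}"
    using codeword_nth_eq_0_iff[OF a] code_gen_carrier by (auto simp: support_def)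
  moreover have "bij_betw (\<lambda>c. proj_point (col G c))
      {c. c < n \<and> \<not> proj_point (col G c) \<subseteq> hyperplane a} {P \<in> X. \<not> P \<subseteq> hyperplane a}"
  proof (rule bij_betw_subset[OF bij])
    show "(\<lambda>c. proj_point (col G c)) ` {c. c < n \<and> \<not> proj_point (col G c) \<subseteq> hyperplane a} =
        {P \<in> X. \<not> P \<subseteq> hyperplane a}"
      using bij_betw_imp_surj_on[OF bij, symmetric] by auto
  qed auto
  ultimately show ?thesis
    unfolding weight_def by (simp only: bij_betw_same_card)
qed

lemma row_space_eq_image: "vec_space.row_space n G = (\<lambda>a. G\<^sup>T *\<^sub>v a) ` carrier_vec k"
  unfolding vec_space.row_space_eq[OF code_gen_carrier] using code_gen_carrier by auto

text \<open>Since \<open>D\<close> is positive, a nonzero \<open>a\<close> never encodes to zero.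
  The encoding is thus injective, which gives dimension \<open>k\<close>. The witness for
  \<open>d\<close> is the least nonzero weight, attained because the code is finite.\<close>

lemma linear_code_from_points:
  assumes "k \<ge> 1" "D \<ge> 1"
    and weight: "\<And>a. a \<in> carrier_vec k \<Longrightarrow> a \<noteq> 0\<^sub>v k \<Longrightarrow> D \<le> card {P \<in> X. \<not> P \<subseteq> hyperplane a}"
  shows "\<exists>d\<ge>D. linear_code n k d (vec_space.row_space n G)"
proof -
  let ?C = "vec_space.row_space n G" and ?w = "\<lambda>a. G\<^sup>T *\<^sub>v a"
  note gc = code_gen_carrier
  have w0: "?w a = 0\<^sub>v n \<longleftrightarrow> a = 0\<^sub>v k" if a: "a \<in> carrier_vec k" for a
  proof
    assume "?w a = 0\<^sub>v n"
    then have "card {P \<in> X. \<not> P \<subseteq> hyperplane a} = 0"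
      using weight_codeword[OF a] by (simp add: weight_zero_vec)
    then show "a = 0\<^sub>v k"
      using weight[OF a] \<open>D \<ge> 1\<close> by (metis le_zero_eq not_one_le_zero)
  qed (use gc in \<open>auto intro!: eq_vecI\<close>)
  have add: "?w (a + b) = ?w a + ?w b" if "a \<in> carrier_vec k" "b \<in> carrier_vec k" for a b
    using mult_add_distrib_mat_vec[of "G\<^sup>T" n k a b] gc that by simp
  have smult: "?w (c \<cdot>\<^sub>v a) = c \<cdot>\<^sub>v ?w a" if "a \<in> carrier_vec k" for a c
    using mult_mat_vec[of "G\<^sup>T" n k a c] gc that by simp
  have carr: "?w a \<in> carrier_vec n" for a
    using gc by (intro carrier_vecI) simp
  have "inj_on ?w (carrier_vec k)"
  proof (rule inj_onI)
    fix a b assume ab: "a \<in> carrier_vec k" "b \<in> carrier_vec k" "?w a = ?w b"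
    have "?w (a + (- 1) \<cdot>\<^sub>v b) = ?w a + (- 1) \<cdot>\<^sub>v ?w b"
      using ab by (simp add: add smult)
    also have "\<dots> = 0\<^sub>v n"
      unfolding ab(3) by (rule add_minus_one_smult_vec[OF carr])
    finally show "a = b"
      using w0[of "a + (- 1) \<cdot>\<^sub>v b"] minus_smult_eq_zero_imp_eq[OF ab(1,2)] ab by simp
  qed
  then have "card ?C = CARD('a) ^ k"
    unfolding row_space_eq_image by (simp add: card_image card_carrier_vec)
  moreover have "0\<^sub>v n \<in> ?C"
    unfolding row_space_eq_image using w0 by (metis imageI zero_carrier_vec)
  moreover have "x + y \<in> ?C" if "x \<in> ?C" "y \<in> ?C" for x y
    using that unfolding row_space_eq_image by (auto simp: add[symmetric])
  moreover have "c \<cdot>\<^sub>v x \<in> ?C" if "x \<in> ?C" for c x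
    using that unfolding row_space_eq_image by (auto simp: smult[symmetric])
  moreover have "?C \<subseteq> carrier_vec n"
    unfolding row_space_eq_image using carr by auto
  ultimately have sub: "?C \<in> subspaces_of_dim n k"
    unfolding subspaces_of_dim_iff by blast
  define W where "W = weight ` (?C - {0\<^sub>v n})"
  have "finite W"
    unfolding W_def using subspaces_of_dim_finite[OF sub] by simp
  moreover have "W \<noteq> {}"
    using subspace_nonzero_vector[OF sub \<open>k \<ge> 1\<close>] unfolding W_def by blast
  ultimately have min: "Min W \<in> W" "\<And>x. x \<in> W \<Longrightarrow> Min W \<le> x"
    by auto
  have "D \<le> x" if "x \<in> W" for x
  proof -
    obtain a where "a \<in> carrier_vec k" "?w a \<noteq> 0\<^sub>v n" "x = weight (?w a)"
      using \<open>x \<in> W\<close> unfolding W_def row_space_eq_image by blast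
    then show ?thesis
      using weight w0 weight_codeword by metis
  qed
  then have "D \<le> Min W"
    using min by blast
  moreover have "linear_code n k (Min W) ?C"
    unfolding linear_code_def using sub min unfolding W_def by auto
  ultimately show ?thesis by blast
qed

text \<open>For the codewords of \<open>a\<close> and \<open>b\<close>, inclusion of supports says
  that each point of \<open>X\<close> on the hyperplane of \<open>a\<close> is on that of
  \<open>b\<close>. So \<open>cut\<close> is minimality restated for functionals.\<close>

lemma minimal_code_from_points:
  assumes cut: "\<And>a b. a \<in> carrier_vec k \<Longrightarrow> b \<in> carrier_vec k \<Longrightarrow>
    (\<And>P. P \<in> X \<Longrightarrow> P \<subseteq> hyperplane a \<Longrightarrow> P \<subseteq> hyperplane b) \<Longrightarrow> \<exists>c. b = c \<cdot>\<^sub>v a"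
  shows "minimal_code n (vec_space.row_space n G)"
  unfolding minimal_code_def minimal_codeword_def row_space_eq_image
proof (intro ballI impI, elim imageE, clarify)
  fix a b :: "'a vec"
  assume ab: "a \<in> carrier_vec k" "b \<in> carrier_vec k"
    and supp: "support (G\<^sup>T *\<^sub>v b) \<subseteq> support (G\<^sup>T *\<^sub>v a)"
  have "P \<subseteq> hyperplane b" if P: "P \<in> X" "P \<subseteq> hyperplane a" for P
  proof -
    obtain c where c: "c < n" "P = proj_point (col G c)"
      using G P(1) unfolding columns_represent_def bij_betw_def by auto
    then have "c \<notin> support (G\<^sup>T *\<^sub>v a)"
      using codeword_nth_eq_0_iff[OF ab(1) c(1)] P(2) by (simp add: support_def)
    then have "c \<notin> support (G\<^sup>T *\<^sub>v b)"
      using supp by blast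
    then show ?thesis
      using codeword_nth_eq_0_iff[OF ab(2) c(1)] c code_gen_carrier by (simp add: support_def)
  qed
  then obtain c where "b = c \<cdot>\<^sub>v a"
    using cut[OF ab] by blast
  then have "G\<^sup>T *\<^sub>v b = c \<cdot>\<^sub>v (G\<^sup>T *\<^sub>v a)"
    using mult_mat_vec[of "G\<^sup>T" n k a c] code_gen_carrier ab by simp
  then show "\<exists>c. G\<^sup>T *\<^sub>v b = c \<cdot>\<^sub>v (G\<^sup>T *\<^sub>v a)"
    by blast
qed

end

subsection \<open>The degree of the minimal polynomial\<close>

text \<open>Evaluation at \<gamma> is a bijection from the polynomials of degree below
  \<open>degree f\<close> onto \<open>'b\<close>: injective by minimality of \<open>f\<close>, and
  surjective because nonzero elements are powers of \<gamma>, whose monomials can be reduced modulo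
  \<open>f\<close>. Counting both sides gives the degree. It is needed with \<open>m = 3\<close>, to
  fix the size of the companion matrix.\<close>

lemma degree_min_poly:
  fixes emb :: "'a::{finite,field} \<Rightarrow> 'b::{finite,field}"
  assumes emb: "field_hom emb" and \<gamma>: "primitive_element \<gamma>" and f: "is_min_poly emb \<gamma> f"
    and card: "CARD('b) = CARD('a) ^ m"
  shows "degree f = m"
proof -
  interpret field_hom emb by (rule emb)
  interpret map_poly_hom: map_poly_comm_ring_hom emb ..
  define T where "T p = poly (map_poly emb p) \<gamma>" for p
  have T_add: "T (p + r) = T p + T r" and T_mult: "T (p * r) = T p * T r"
    and T_diff: "T (p - r) = T p - T r" for p r
    by (simp_all add: T_def hom_distribs)
  have f0: "f \<noteq> 0" and Tf: "T f = 0"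
    and min: "\<And>r. r \<noteq> 0 \<Longrightarrow> T r = 0 \<Longrightarrow> degree f \<le> degree r"
    using f unfolding is_min_poly_def T_def by auto
  \<comment> \<open>The coefficient condition admits the zero polynomial whatever the degree of
    \<open>f\<close> is.\<close>
  define A where "A = {p :: 'a poly. \<forall>i\<ge>degree f. coeff p i = 0}"
  have "inj_on T A"
  proof (rule inj_onI, rule ccontr)
    fix p r assume pr: "p \<in> A" "r \<in> A" "T p = T r" "p \<noteq> r"
    then have "p - r \<noteq> 0" and "degree f \<le> degree (p - r)"
      using min[of "p - r"] by (auto simp: T_diff)
    then have "lead_coeff (p - r) = 0"
      using pr unfolding A_def by simp
    with \<open>p - r \<noteq> 0\<close> show False
      by (metis leading_coeff_0_iff)
  qed
  moreover have "T ` A = UNIV"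
  proof (intro equalityI subsetI)
    fix y :: 'b
    show "y \<in> T ` A"
    proof (cases "y = 0")
      case True
      then have "y = T 0" "0 \<in> A"
        by (auto simp: T_def A_def)
      then show ?thesis by blast
    next
      case False
      then obtain k where y: "y = \<gamma> ^ k"
        using \<gamma> unfolding primitive_element_def by blast
      have "T (monom 1 k) = y"
        by (simp add: T_def y poly_monom)
      moreover have "T (monom 1 k) = T (monom 1 k mod f)"
        using T_add[of "monom 1 k div f * f" "monom 1 k mod f"] T_mult Tf by simp
      moreover have "monom 1 k mod f \<in> A"
        using degree_mod_less[OF f0, of "monom 1 k"] unfolding A_def
        by (auto intro: coeff_eq_0)
      ultimately show ?thesis by blast
    qed
  qed simp
  ultimately have "card A = CARD('b)"
    by (metis card_image)
  moreover have "bij_betw (\<lambda>p. vec (degree f) (coeff p)) A (carrier_vec (degree f))"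
  proof (rule bij_betw_imageI)
    show "inj_on (\<lambda>p. vec (degree f) (coeff p)) A"
    proof (rule inj_onI)
      fix p r assume pr: "p \<in> A" "r \<in> A" and e: "vec (degree f) (coeff p) = vec (degree f) (coeff r)"
      have "coeff p i = coeff r i" for i
        using pr arg_cong[OF e, of "\<lambda>v. v $ i"] unfolding A_def
        by (cases "i < degree f") auto
      then show "p = r"
        by (simp add: poly_eq_iff)
    qed
    show "(\<lambda>p. vec (degree f) (coeff p)) ` A = carrier_vec (degree f)"
    proof (intro equalityI subsetI)
      fix v :: "'a vec" assume v: "v \<in> carrier_vec (degree f)"
      define p where "p = Poly (list_of_vec v)"
      have "coeff p i = (if i < degree f then v $ i else 0)" for i
        using v by (auto simp: p_def nth_default_def list_of_vec_index)
      then have "p \<in> A" "vec (degree f) (coeff p) = v"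
        using v unfolding A_def by (auto intro!: eq_vecI)
      then show "v \<in> (\<lambda>p. vec (degree f) (coeff p)) ` A"
        by blast
    qed auto
  qed
  ultimately have "CARD('a) ^ degree f = CARD('a) ^ m"
    using card by (metis bij_betw_same_card card_carrier_vec)
  then show ?thesis
    using card_field_ge_2[where 'a='a] by (simp add: power_inject_exp)
qed

subsection \<open>Powers of a primitive element\<close>

text \<open>Multiplication by \<open>c\<close> permutes the nonzero elements; compare their product
  before and after.\<close>

lemma finite_field_power_card_minus_1:
  fixes c :: "'a::{finite,field}"
  assumes "c \<noteq> 0"
  shows "c ^ (CARD('a) - 1) = 1"
proof -
  have "bij_betw (\<lambda>x. c * x) (- {0}) (- {0})"
    using assms by (intro bij_betwI[of _ _ _ "\<lambda>x. x / c"]) auto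
  then have "(\<Prod>x\<in>- {0}. c * x) = \<Prod>(- {0})"
    by (rule prod.reindex_bij_betw)
  then have "c ^ card (- {0::'a}) * \<Prod>(- {0}) = \<Prod>(- {0})"
    by (simp add: prod.distrib)
  moreover have "\<Prod>(- {0::'a}) \<noteq> 0"
    by (subst prod_zero_iff) auto
  ultimately have "c ^ card (- {0::'a}) = 1"
    by simp
  then show ?thesis
    by (simp add: Compl_eq_Diff_UNIV card_Diff_singleton)
qed

text \<open>Let r be the remainder of \<open>N\<close>. Then \<open>\<gamma> ^ r = 1\<close>, and if
  r were positive, \<gamma> would have at most r distinct powers, too few for all nonzero
  elements.\<close>

lemma primitive_element_power_eq_1_dvd:
  fixes \<gamma> :: "'b::{finite,field}"
  assumes \<gamma>: "primitive_element \<gamma>" and N: "\<gamma> ^ N = 1"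
  shows "CARD('b) - 1 dvd N"
proof -
  let ?r = "N mod (CARD('b) - 1)"
  have c: "card (- {0::'b}) = CARD('b) - 1"
    by (simp add: Compl_eq_Diff_UNIV card_Diff_singleton)
  have "\<gamma> \<noteq> 0"
  proof
    assume "\<gamma> = 0"
    moreover have "\<gamma> ^ 1 \<in> - {0}"
      using \<gamma> unfolding primitive_element_def by blast
    ultimately show False by simp
  qed
  then have "\<gamma> ^ (CARD('b) - 1) = 1"
    by (rule finite_field_power_card_minus_1)
  then have "\<gamma> ^ N = \<gamma> ^ ?r"
    using arg_cong[OF mult_div_mod_eq[of "CARD('b) - 1" N], of "\<lambda>m. \<gamma> ^ m"]
    by (simp only: power_add power_mult power_one mult_1)
  then have r: "\<gamma> ^ ?r = 1"
    using N by simp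
  have "?r = 0"
  proof (rule ccontr)
    assume r0: "?r \<noteq> 0"
    have "\<gamma> ^ k = \<gamma> ^ (k mod ?r)" for k
      using arg_cong[OF mult_div_mod_eq[of ?r k], of "\<lambda>m. \<gamma> ^ m"] r
      by (simp only: power_add power_mult power_one mult_1)
    moreover have "k mod ?r < ?r" for k
      using r0 by simp
    ultimately have "range (\<lambda>k. \<gamma> ^ k) \<subseteq> (\<lambda>k. \<gamma> ^ k) ` {..<?r}"
      by blast
    then have "card (- {0::'b}) \<le> card {..<?r}"
      using \<gamma> unfolding primitive_element_def by (simp only: surj_card_le[OF finite_lessThan])
    moreover have "?r < CARD('b) - 1"
      using card_field_ge_2[where 'a='b] by simp
    ultimately show False
      using c by simp
  qed
  then show ?thesis by blast
qed

text \<open>Raising to the power q - 1 removes the factors from F_q. So q^3 - 1 divides (j - i)(q -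
  1), and q - 1 cancels.\<close>

lemma primitive_power_ratio:
  fixes emb :: "'a::{finite,field} \<Rightarrow> 'b::{finite,field}"
  assumes emb: "field_hom emb" and \<gamma>: "primitive_element \<gamma>"
    and card: "CARD('b) = CARD('a) ^ 3"
    and eq: "\<gamma> ^ i * emb c = \<gamma> ^ j * emb d" and cd: "c \<noteq> 0" "d \<noteq> 0"
  shows "(int j - int i) mod int (CARD('a)\<^sup>2 + CARD('a) + 1) = 0"
proof -
  interpret field_hom emb by (rule emb)
  let ?q = "CARD('a)"
  obtain p where p: "?q = Suc (Suc p)"
    using card_field_ge_2[where 'a='a] by (metis Suc_le_D numeral_2_eq_2 Suc_le_mono)
  have emb1: "emb x ^ (?q - 1) = 1" if "x \<noteq> 0" for x
    using finite_field_power_card_minus_1[OF that] by (metis hom_power hom_one)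
  \<comment> \<open>First for \<open>i \<le> j\<close>, so that the exponent difference is a natural
    number; the other case swaps the roles of \<open>i\<close> and \<open>j\<close>.\<close>
  have key: "int (?q\<^sup>2 + ?q + 1) dvd int j - int i"
    if e: "\<gamma> ^ i * emb c = \<gamma> ^ j * emb d" and cd: "c \<noteq> 0" "d \<noteq> 0" and ij: "i \<le> j" for i j c d
  proof -
    have \<gamma>0: "\<gamma> \<noteq> 0"
      using \<gamma> unfolding primitive_element_def
      by (metis ComplD power_one_right rangeI singletonI)
    have "(\<gamma> ^ i * emb c) ^ (?q - 1) = (\<gamma> ^ j * emb d) ^ (?q - 1)"
      by (simp only: e)
    then have "\<gamma> ^ (i * (?q - 1)) = \<gamma> ^ (j * (?q - 1))"
      using cd emb1 by (simp add: power_mult_distrib power_mult)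
    also have "j * (?q - 1) = i * (?q - 1) + (j - i) * (?q - 1)"
      using ij by (metis add_mult_distrib le_add_diff_inverse)
    finally have "\<gamma> ^ ((j - i) * (?q - 1)) = 1"
      using \<gamma>0 by (simp add: power_add)
    then have "?q ^ 3 - 1 dvd (j - i) * (?q - 1)"
      using primitive_element_power_eq_1_dvd[OF \<gamma>] card by metis
    moreover have "?q ^ 3 - 1 = (?q\<^sup>2 + ?q + 1) * (?q - 1)"
      unfolding p by (simp add: power2_eq_square power3_eq_cube algebra_simps)
    ultimately have "(?q - 1) * (?q\<^sup>2 + ?q + 1) dvd (?q - 1) * (j - i)"
      by (simp only: mult.commute[of "?q - 1"])
    moreover have "?q - 1 \<noteq> 0"
      unfolding p by simp
    ultimately have "?q\<^sup>2 + ?q + 1 dvd j - i"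
      unfolding nat_mult_dvd_cancel_disj by (elim disjE) (rule notE)
    then have "int (?q\<^sup>2 + ?q + 1) dvd int (j - i)"
      by (simp only: of_nat_dvd_iff)
    then show ?thesis
      using ij by (simp add: of_nat_diff)
  qed
  show ?thesis
  proof (cases "i \<le> j")
    case True
    then show ?thesis
      using key[OF eq cd] by (simp only: dvd_eq_mod_eq_0)
  next
    case False
    then have "int (?q\<^sup>2 + ?q + 1) dvd int i - int j"
      using key[OF eq[symmetric] cd(2,1)] by simp
    then show ?thesis
      using dvd_minus_iff[of _ "int i - int j"] by (simp only: minus_diff_eq dvd_eq_mod_eq_0)
  qed
qed

subsection \<open>Matrix representations of a field\<close>

lemma add_eq_self_vec:
  fixes x y :: "'a::ab_group_add vec"
  assumes "x \<in> carrier_vec n" "y \<in> carrier_vec n" and e: "x + y = y"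
  shows "x = 0\<^sub>v n"
proof (rule eq_vecI)
  fix i assume i: "i < dim_vec (0\<^sub>v n :: 'a vec)"
  have "(x + y) $ i = y $ i"
    by (simp only: e)
  then show "x $ i = 0\<^sub>v n $ i"
    using assms(1,2) i by simp
qed (use assms in simp)

lemma add_eq_zero_vec_cancel:
  fixes U V V' :: "'a::ab_group_add vec"
  assumes "U \<in> carrier_vec n" "V \<in> carrier_vec n" "V' \<in> carrier_vec n"
    and "U + V = 0\<^sub>v n" "U + V' = 0\<^sub>v n"
  shows "V = V'"
proof (rule eq_vecI)
  fix r assume r: "r < dim_vec V'"
  then show "V $ r = V' $ r"
    using assms(1-3) arg_cong[OF assms(4), of "\<lambda>v. v $ r"] arg_cong[OF assms(5), of "\<lambda>v. v $ r"]
    by (simp add: add_eq_0_iff)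
qed (use assms in simp)

lemma vec_eq_if_scalar_prods_eq:
  fixes x z :: "'a::comm_ring_1 vec"
  assumes "x \<in> carrier_vec d" "z \<in> carrier_vec d" "\<And>y. y \<in> carrier_vec d \<Longrightarrow> x \<bullet> y = z \<bullet> y"
  shows "x = z"
proof (rule eq_vecI)
  fix i assume "i < dim_vec z"
  then show "x $ i = z $ i"
    using assms(3)[of "unit_vec d i"] assms(1,2) by simp
qed (use assms in simp)

text \<open>Such a \<phi> makes \<open>carrier_vec m\<close> a vector space over \<open>'b\<close>,
  with scalar multiplication \<open>\<phi> x *\<^sub>v u\<close>. The \<open>act\<close> lemmas are
  its laws and cancellation rules.\<close>

locale field_matrix_rep =
  fixes \<phi> :: "'b::field \<Rightarrow> 'a::field mat" and m :: nat
  assumes carrier [simp]: "\<phi> x \<in> carrier_mat m m"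
    and add: "\<phi> (x + y) = \<phi> x + \<phi> y"
    and mult: "\<phi> (x * y) = \<phi> x * \<phi> y"
    and one: "\<phi> 1 = 1\<^sub>m m"
begin

lemma dim_rep [simp]: "dim_row (\<phi> x) = m" "dim_col (\<phi> x) = m"
  using carrier[of x] by (simp_all del: carrier)

text \<open>Transposition reverses products, which is harmless because \<open>'b\<close> is
  commutative. Row space vectors have blocks \<open>(\<phi> (v $ l))\<^sup>T *\<^sub>v y\<close>, so
  they are governed by this transposed action.\<close>

lemma transpose_rep: "field_matrix_rep (\<lambda>x. (\<phi> x)\<^sup>T) m"
proof
  fix x y
  show "(\<phi> (x + y))\<^sup>T = (\<phi> x)\<^sup>T + (\<phi> y)\<^sup>T"
    by (simp add: add transpose_add[OF carrier carrier])
  show "(\<phi> (x * y))\<^sup>T = (\<phi> x)\<^sup>T * (\<phi> y)\<^sup>T"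
    using transpose_mult[OF carrier carrier, of y x] by (simp add: mult[symmetric] mult.commute)
qed (simp_all add: one transpose_one)

lemma act_carrier [simp]: "\<phi> x *\<^sub>v u \<in> carrier_vec m"
  by (intro carrier_vecI) simp

lemma act_mult:
  assumes "u \<in> carrier_vec m"
  shows "\<phi> x *\<^sub>v (\<phi> y *\<^sub>v u) = \<phi> (x * y) *\<^sub>v u"
  unfolding mult by (rule assoc_mult_mat_vec[OF carrier carrier assms, symmetric])

lemma act_one: "u \<in> carrier_vec m \<Longrightarrow> \<phi> 1 *\<^sub>v u = u"
  by (simp add: one)

lemma act_add: "u \<in> carrier_vec m \<Longrightarrow> \<phi> (x + y) *\<^sub>v u = \<phi> x *\<^sub>v u + \<phi> y *\<^sub>v u"
  unfolding add by (rule add_mult_distrib_mat_vec[OF carrier carrier])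

lemma act_zero_vec [simp]: "\<phi> x *\<^sub>v 0\<^sub>v m = 0\<^sub>v m"
  by (auto intro!: eq_vecI)

lemma act_zero [simp]:
  assumes "u \<in> carrier_vec m"
  shows "\<phi> 0 *\<^sub>v u = 0\<^sub>v m"
proof (rule add_eq_self_vec[OF act_carrier act_carrier])
  show "\<phi> 0 *\<^sub>v u + \<phi> 0 *\<^sub>v u = \<phi> 0 *\<^sub>v u"
    using act_add[OF assms, of 0 0] by simp
qed

text \<open>For nonzero \<open>x\<close> the matrix \<open>\<phi> x\<close> is inverted by
  \<open>\<phi> (inverse x)\<close>.\<close>

lemma act_eq_zero_iff:
  assumes "u \<in> carrier_vec m"
  shows "\<phi> x *\<^sub>v u = 0\<^sub>v m \<longleftrightarrow> x = 0 \<or> u = 0\<^sub>v m"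
proof
  assume e: "\<phi> x *\<^sub>v u = 0\<^sub>v m"
  have "u = 0\<^sub>v m" if "x \<noteq> 0"
  proof -
    have "\<phi> (inverse x) *\<^sub>v (\<phi> x *\<^sub>v u) = u"
      using that act_mult[OF assms] act_one[OF assms] by simp
    then show ?thesis
      unfolding e by simp
  qed
  then show "x = 0 \<or> u = 0\<^sub>v m" by blast
qed (use assms in auto)

lemma act_right_cancel:
  assumes "u \<in> carrier_vec m" "u \<noteq> 0\<^sub>v m" and e: "\<phi> x *\<^sub>v u = \<phi> y *\<^sub>v u"
  shows "x = y"
proof -
  have "\<phi> (x - y) *\<^sub>v u + \<phi> y *\<^sub>v u = \<phi> y *\<^sub>v u"
    using act_add[OF assms(1), of "x - y" y] e by simp
  then have "\<phi> (x - y) *\<^sub>v u = 0\<^sub>v m"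
    by (rule add_eq_self_vec[OF act_carrier act_carrier])
  then show ?thesis
    using act_eq_zero_iff[OF assms(1)] assms(2) by simp
qed

lemma act_left_cancel:
  assumes "u \<in> carrier_vec m" "v \<in> carrier_vec m" "x \<noteq> 0" "\<phi> x *\<^sub>v u = \<phi> x *\<^sub>v v"
  shows "u = v"
proof -
  have "\<phi> (inverse x) *\<^sub>v (\<phi> x *\<^sub>v u) = \<phi> (inverse x) *\<^sub>v (\<phi> x *\<^sub>v v)"
    by (simp only: assms(4))
  then show ?thesis
    using assms(1-3) by (simp add: act_mult act_one)
qed

end

section \<open>Vectors of length 3t as t blocks of length 3\<close>

definition vec_block :: "'a vec \<Rightarrow> nat \<Rightarrow> 'a vec" where
  "vec_block a l = vec 3 (\<lambda>s. a $ (3 * l + s))"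

lemma vec_block_carrier [simp]: "vec_block a l \<in> carrier_vec 3"
  by (simp add: vec_block_def)

lemma vec_eq_if_blocks_eq:
  assumes "a \<in> carrier_vec (3 * t)" "b \<in> carrier_vec (3 * t)"
    and "\<And>l. l < t \<Longrightarrow> vec_block a l = vec_block b l"
  shows "a = b"
proof (rule eq_vecI)
  fix c assume "c < dim_vec b"
  then have l: "c div 3 < t"
    using assms by (simp add: less_mult_imp_div_less mult.commute)
  have "vec_block a (c div 3) $ (c mod 3) = vec_block b (c div 3) $ (c mod 3)"
    by (simp only: assms(3)[OF l])
  then show "a $ c = b $ c"
    by (simp add: vec_block_def)
qed (use assms in simp)

lemma vec_block_smult:
  assumes "a \<in> carrier_vec (3 * t)" "l < t"
  shows "vec_block (c \<cdot>\<^sub>v a) l = c \<cdot>\<^sub>v vec_block a l"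
  using assms by (auto simp: vec_block_def intro!: eq_vecI)

lemma vec_block_zero: "l < t \<Longrightarrow> vec_block (0\<^sub>v (3 * t)) l = 0\<^sub>v 3"
  by (auto simp: vec_block_def intro!: eq_vecI)

subsection \<open>Field reduction\<close>

locale field_reduction_rep = field_matrix_rep \<phi> 3
  for \<phi> :: "'b::{finite,field} \<Rightarrow> 'a::{finite,field} mat"
begin

sublocale T: field_matrix_rep "\<lambda>x. (\<phi> x)\<^sup>T" 3
  by (rule transpose_rep)

lemma block_row_carrier: "v \<in> carrier_vec t \<Longrightarrow> block_row \<phi> v \<in> carrier_mat 3 (3 * t)"
  by (auto simp: block_row_def)

text \<open>Grouping the 3t columns into triples shows that the product is the
  \<open>'b\<close>-linear combination of the blocks of \<open>a\<close> with coefficients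
  \<open>v $ l\<close>.\<close>

lemma block_row_mult_nth:
  assumes v: "v \<in> carrier_vec t" and a: "a \<in> carrier_vec (3 * t)" and r: "r < 3"
  shows "(block_row \<phi> v *\<^sub>v a) $ r = (\<Sum>l<t. (\<phi> (v $ l) *\<^sub>v vec_block a l) $ r)"
proof -
  let ?g = "\<lambda>c. \<phi> (v $ (c div 3)) $$ (r, c mod 3) * a $ c"
  have "(block_row \<phi> v *\<^sub>v a) $ r = (\<Sum>c<t * 3. ?g c)"
    using v a r by (auto simp: block_row_def scalar_prod_def mult.commute lessThan_atLeast0 intro!: sum.cong)
  also have "\<dots> = (\<Sum>l<t. \<Sum>c=l*3..<l*3+3. ?g c)"
    by (rule sum.nat_group[symmetric])
  also have "\<dots> = (\<Sum>l<t. (\<phi> (v $ l) *\<^sub>v vec_block a l) $ r)"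
  proof (rule sum.cong[OF refl])
    fix l assume "l \<in> {..<t}"
    have "(\<Sum>c=l*3..<l*3+3. ?g c) = (\<Sum>s=0..<3. ?g (s + l * 3))"
      using sum.shift_bounds_nat_ivl[of ?g 0 "l * 3" 3] by (simp add: add.commute)
    also have "\<dots> = (\<phi> (v $ l) *\<^sub>v vec_block a l) $ r"
      using r by (auto simp: scalar_prod_def vec_block_def mult.commute add.commute intro!: sum.cong)
    finally show "(\<Sum>c=l*3..<l*3+3. ?g c) = (\<phi> (v $ l) *\<^sub>v vec_block a l) $ r" .
  qed
  finally show ?thesis .
qed

lemma vec_block_transpose_block_row:
  assumes v: "v \<in> carrier_vec t" and y: "y \<in> carrier_vec 3" and l: "l < t"
  shows "vec_block ((block_row \<phi> v)\<^sup>T *\<^sub>v y) l = (\<phi> (v $ l))\<^sup>T *\<^sub>v y"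
proof (rule eq_vecI)
  fix s assume "s < dim_vec ((\<phi> (v $ l))\<^sup>T *\<^sub>v y)"
  then have s: "s < 3"
    by simp
  then have "3 * l + s < 3 * t"
    using l by simp
  then show "vec_block ((block_row \<phi> v)\<^sup>T *\<^sub>v y) l $ s = ((\<phi> (v $ l))\<^sup>T *\<^sub>v y) $ s"
    using s v y l
    by (auto simp: vec_block_def block_row_def scalar_prod_def intro!: sum.cong)
qed (simp add: vec_block_def)

text \<open>A change of the representative of a point only multiplies by
  \<open>\<phi> \<mu>\<close>, which is invertible for nonzero \<mu>.\<close>

lemma block_row_mult_smult:
  assumes v: "v \<in> carrier_vec t" and a: "a \<in> carrier_vec (3 * t)"
  shows "block_row \<phi> (\<mu> \<cdot>\<^sub>v v) *\<^sub>v a = \<phi> \<mu> *\<^sub>v (block_row \<phi> v *\<^sub>v a)"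
proof (rule eq_vecI)
  fix r assume "r < dim_vec (\<phi> \<mu> *\<^sub>v (block_row \<phi> v *\<^sub>v a))"
  then have r: "r < 3"
    by simp
  have "(block_row \<phi> (\<mu> \<cdot>\<^sub>v v) *\<^sub>v a) $ r = (\<Sum>l<t. (\<phi> \<mu> *\<^sub>v (\<phi> (v $ l) *\<^sub>v vec_block a l)) $ r)"
    using v by (subst block_row_mult_nth[OF _ a r]) (auto simp: act_mult intro!: sum.cong)
  also have "\<dots> = (\<Sum>l<t. \<Sum>s<3. \<phi> \<mu> $$ (r, s) * (\<phi> (v $ l) *\<^sub>v vec_block a l) $ s)"
    using r by (intro sum.cong) (auto simp: scalar_prod_def lessThan_atLeast0)
  also have "\<dots> = (\<Sum>s<3. \<phi> \<mu> $$ (r, s) * (\<Sum>l<t. (\<phi> (v $ l) *\<^sub>v vec_block a l) $ s))"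
    by (subst sum.swap) (simp add: sum_distrib_left)
  also have "\<dots> = (\<Sum>s<3. \<phi> \<mu> $$ (r, s) * (block_row \<phi> v *\<^sub>v a) $ s)"
    by (intro sum.cong refl) (simp add: block_row_mult_nth[OF v a])
  also have "\<dots> = (\<phi> \<mu> *\<^sub>v (block_row \<phi> v *\<^sub>v a)) $ r"
    using r block_row_carrier[OF v]
    by (simp add: scalar_prod_def[of "row (\<phi> \<mu>) r"] lessThan_atLeast0)
  finally show "(block_row \<phi> (\<mu> \<cdot>\<^sub>v v) *\<^sub>v a) $ r = (\<phi> \<mu> *\<^sub>v (block_row \<phi> v *\<^sub>v a)) $ r" .
qed (simp add: block_row_def)

definition red_plane :: "nat \<Rightarrow> 'b vec \<Rightarrow> 'a vec set" where
  "red_plane t v = field_reduction \<phi> t (proj_point v)"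

text \<open>The representative picked by \<open>SOME\<close> in \<open>field_reduction\<close> is
  known only up to a nonzero factor \<mu>, which later proofs carry along and cancel.\<close>

lemma red_plane_eq:
  assumes v: "v \<in> carrier_vec t" "v \<noteq> 0\<^sub>v t"
  obtains \<mu> where "\<mu> \<noteq> 0"
    "red_plane t v = (\<lambda>y. (block_row \<phi> (\<mu> \<cdot>\<^sub>v v))\<^sup>T *\<^sub>v y) ` carrier_vec 3"
proof -
  define w where "w = (SOME w. w \<in> proj_point v \<and> w \<noteq> 0\<^sub>v t)"
  have "w \<in> proj_point v \<and> w \<noteq> 0\<^sub>v t"
    unfolding w_def by (rule someI[of _ v]) (simp add: v self_in_proj_point)
  then obtain \<mu> where \<mu>: "w = \<mu> \<cdot>\<^sub>v v" "w \<noteq> 0\<^sub>v t"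
    unfolding proj_point_eq by blast
  have "\<mu> \<noteq> 0"
    using \<mu> smult_eq_zero_vec_iff[OF v(1)] by blast
  moreover have c: "block_row \<phi> w \<in> carrier_mat 3 (3 * t)"
    using block_row_carrier[of w t] v \<mu> by simp
  have "red_plane t v = (\<lambda>y. (block_row \<phi> w)\<^sup>T *\<^sub>v y) ` carrier_vec 3"
    unfolding red_plane_def field_reduction_def w_def[symmetric] vec_space.row_space_eq[OF c]
    using c by auto
  ultimately show ?thesis
    using that \<mu> by blast
qed

text \<open>In the row coordinates \<open>y\<close> of the plane, the functional \<open>a\<close> is
  represented by \<open>block_row \<phi> v *\<^sub>v a\<close>.\<close>

lemma red_plane_functional:
  assumes v: "v \<in> carrier_vec t" and a: "a \<in> carrier_vec (3 * t)" and y: "y \<in> carrier_vec 3"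
  shows "a \<bullet> ((block_row \<phi> v)\<^sup>T *\<^sub>v y) = (block_row \<phi> v *\<^sub>v a) \<bullet> y"
  using transpose_vec_mult_scalar[OF block_row_carrier[OF v] a y]
    comm_scalar_prod[OF a, of "(block_row \<phi> v)\<^sup>T *\<^sub>v y"]
    comm_scalar_prod[OF y, of "block_row \<phi> v *\<^sub>v a"] block_row_carrier[OF v]
  by (metis carrier_vecI dim_mult_mat_vec carrier_matD index_transpose_mat(2))

text \<open>Testing against all \<open>y\<close> gives the identity for the chosen representative.
  As \<open>c\<close> is in the ground field it commutes with \<open>\<phi> \<mu>\<close>, which can
  then be cancelled.\<close>

lemma red_plane_proportional:
  assumes v: "v \<in> carrier_vec t" "v \<noteq> 0\<^sub>v t"
    and a: "a \<in> carrier_vec (3 * t)" and b: "b \<in> carrier_vec (3 * t)"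
    and prp: "\<And>x. x \<in> red_plane t v \<Longrightarrow> b \<bullet> x = c * (a \<bullet> x)"
  shows "block_row \<phi> v *\<^sub>v b = c \<cdot>\<^sub>v (block_row \<phi> v *\<^sub>v a)"
proof -
  obtain \<mu> where \<mu>: "\<mu> \<noteq> 0" "red_plane t v = (\<lambda>y. (block_row \<phi> (\<mu> \<cdot>\<^sub>v v))\<^sup>T *\<^sub>v y) ` carrier_vec 3"
    using red_plane_eq[OF v] by blast
  let ?w = "\<mu> \<cdot>\<^sub>v v"
  have w: "?w \<in> carrier_vec t"
    using v by simp
  have c3: "block_row \<phi> u *\<^sub>v x \<in> carrier_vec 3" for u x
    by (intro carrier_vecI) (simp add: block_row_def)
  have "block_row \<phi> ?w *\<^sub>v b = c \<cdot>\<^sub>v (block_row \<phi> ?w *\<^sub>v a)"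
  proof (rule vec_eq_if_scalar_prods_eq)
    fix y :: "'a vec" assume y: "y \<in> carrier_vec 3"
    have "b \<bullet> ((block_row \<phi> ?w)\<^sup>T *\<^sub>v y) = c * (a \<bullet> ((block_row \<phi> ?w)\<^sup>T *\<^sub>v y))"
      using prp y unfolding \<mu>(2) by blast
    then show "(block_row \<phi> ?w *\<^sub>v b) \<bullet> y = (c \<cdot>\<^sub>v (block_row \<phi> ?w *\<^sub>v a)) \<bullet> y"
      unfolding red_plane_functional[OF w a y] red_plane_functional[OF w b y]
      using smult_scalar_prod_distrib[OF c3 y] by metis
  qed (use c3 in auto)
  then have "\<phi> \<mu> *\<^sub>v (block_row \<phi> v *\<^sub>v b) = c \<cdot>\<^sub>v (\<phi> \<mu> *\<^sub>v (block_row \<phi> v *\<^sub>v a))"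
    unfolding block_row_mult_smult[OF v(1) a] block_row_mult_smult[OF v(1) b] .
  also have "\<dots> = \<phi> \<mu> *\<^sub>v (c \<cdot>\<^sub>v (block_row \<phi> v *\<^sub>v a))"
    by (rule mult_mat_vec[OF carrier c3, symmetric])
  finally show ?thesis
    by (intro act_left_cancel[OF c3 _ \<mu>(1)]) (simp add: c3)
qed

lemma red_plane_subset_hyperplane_imp:
  assumes v: "v \<in> carrier_vec t" "v \<noteq> 0\<^sub>v t" and a: "a \<in> carrier_vec (3 * t)"
    and sub: "red_plane t v \<subseteq> hyperplane a"
  shows "block_row \<phi> v *\<^sub>v a = 0\<^sub>v 3"
proof -
  have "block_row \<phi> v *\<^sub>v a = 0 \<cdot>\<^sub>v (block_row \<phi> v *\<^sub>v a)"
    \<comment> \<open>The case \<open>b = a\<close> with factor 0.\<close>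
    by (rule red_plane_proportional[OF v a a]) (use sub in \<open>auto simp: hyperplane_def\<close>)
  also have "\<dots> = 0\<^sub>v 3"
    by (auto simp: block_row_def intro!: eq_vecI)
  finally show ?thesis .
qed

lemma transpose_block_row_eq_zero:
  assumes v: "v \<in> carrier_vec t" "v \<noteq> 0\<^sub>v t" and y: "y \<in> carrier_vec 3"
    and e: "(block_row \<phi> v)\<^sup>T *\<^sub>v y = 0\<^sub>v (3 * t)"
  shows "y = 0\<^sub>v 3"
proof -
  obtain l where l: "l < t" "v $ l \<noteq> 0"
    using v by (metis carrier_vecD eq_vecI index_zero_vec)
  have "(\<phi> (v $ l))\<^sup>T *\<^sub>v y = 0\<^sub>v 3"
    using vec_block_transpose_block_row[OF v(1) y l(1)] vec_block_zero[OF l(1)] unfolding e by metis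
  then show ?thesis
    using T.act_eq_zero_iff[OF y] l by blast
qed

lemma red_plane_in_subspaces:
  assumes v: "v \<in> carrier_vec t" "v \<noteq> 0\<^sub>v t"
  shows "red_plane t v \<in> subspaces_of_dim (3 * t) 3"
proof -
  obtain \<mu> where \<mu>: "\<mu> \<noteq> 0" "red_plane t v = (\<lambda>y. (block_row \<phi> (\<mu> \<cdot>\<^sub>v v))\<^sup>T *\<^sub>v y) ` carrier_vec 3"
    using red_plane_eq[OF v] by blast
  define A where "A = (block_row \<phi> (\<mu> \<cdot>\<^sub>v v))\<^sup>T"
  have \<mu>v: "\<mu> \<cdot>\<^sub>v v \<in> carrier_vec t" "\<mu> \<cdot>\<^sub>v v \<noteq> 0\<^sub>v t"
    using v \<mu> smult_eq_zero_vec_iff[OF v(1)] by auto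
  have A: "A \<in> carrier_mat (3 * t) 3"
    unfolding A_def using block_row_carrier[OF \<mu>v(1)] by simp
  have eq: "red_plane t v = (\<lambda>y. A *\<^sub>v y) ` carrier_vec 3"
    unfolding \<mu>(2) A_def ..
  have add: "A *\<^sub>v (x + y) = A *\<^sub>v x + A *\<^sub>v y" if "x \<in> carrier_vec 3" "y \<in> carrier_vec 3" for x y
    by (rule mult_add_distrib_mat_vec[OF A that])
  have smult: "A *\<^sub>v (c \<cdot>\<^sub>v x) = c \<cdot>\<^sub>v (A *\<^sub>v x)" if "x \<in> carrier_vec 3" for x c
    by (rule mult_mat_vec[OF A that])
  have carr: "A *\<^sub>v x \<in> carrier_vec (3 * t)" for x
    using A by (intro carrier_vecI) simp
  have "inj_on (\<lambda>y. A *\<^sub>v y) (carrier_vec 3)"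
  proof (rule inj_onI)
    fix x y assume xy: "x \<in> carrier_vec 3" "y \<in> carrier_vec 3" "A *\<^sub>v x = A *\<^sub>v y"
    have "A *\<^sub>v (x + (- 1) \<cdot>\<^sub>v y) = A *\<^sub>v x + (- 1) \<cdot>\<^sub>v (A *\<^sub>v y)"
      using xy by (simp add: add smult)
    also have "\<dots> = 0\<^sub>v (3 * t)"
      unfolding xy(3) by (rule add_minus_one_smult_vec[OF carr])
    finally have "x + (- 1) \<cdot>\<^sub>v y = 0\<^sub>v 3"
      unfolding A_def using transpose_block_row_eq_zero[OF \<mu>v] xy by simp
    then show "x = y"
      by (rule minus_smult_eq_zero_imp_eq[OF xy(1,2)])
  qed
  then have "card (red_plane t v) = CARD('a) ^ 3"
    unfolding eq by (simp add: card_image card_carrier_vec)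
  moreover have "A *\<^sub>v 0\<^sub>v 3 = 0\<^sub>v (3 * t)"
    using A by (auto intro!: eq_vecI)
  then have "0\<^sub>v (3 * t) \<in> red_plane t v"
    unfolding eq by (metis imageI zero_carrier_vec)
  moreover have "x + y \<in> red_plane t v" if "x \<in> red_plane t v" "y \<in> red_plane t v" for x y
    using that unfolding eq by (auto simp: add[symmetric])
  moreover have "c \<cdot>\<^sub>v x \<in> red_plane t v" if "x \<in> red_plane t v" for c x
    using that unfolding eq by (auto simp: smult[symmetric])
  moreover have "red_plane t v \<subseteq> carrier_vec (3 * t)"
    unfolding eq using carr by auto
  ultimately show ?thesis
    unfolding subspaces_of_dim_iff by blast
qed

text \<open>Distinct points of PG(t - 1, q^3) have disjoint planes. Let the common vector have row
  coordinates \<open>y\<close> and \<open>z\<close> in the two planes. A block where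
  \<open>v\<close> is nonzero expresses \<open>y\<close> as a multiple of \<open>z\<close>, and
  comparing all blocks makes \<open>w\<close> proportional to \<open>v\<close>.\<close>

lemma red_planes_common_vector:
  assumes v: "v \<in> carrier_vec t" "v \<noteq> 0\<^sub>v t" and w: "w \<in> carrier_vec t" "w \<noteq> 0\<^sub>v t"
    and x: "x \<in> red_plane t v" "x \<in> red_plane t w" "x \<noteq> 0\<^sub>v (3 * t)"
  shows "\<exists>\<kappa>. w = \<kappa> \<cdot>\<^sub>v v"
proof -
  obtain \<mu> where \<mu>: "\<mu> \<noteq> 0" "red_plane t v = (\<lambda>y. (block_row \<phi> (\<mu> \<cdot>\<^sub>v v))\<^sup>T *\<^sub>v y) ` carrier_vec 3"
    using red_plane_eq[OF v] by blast
  obtain \<nu> where \<nu>: "\<nu> \<noteq> 0" "red_plane t w = (\<lambda>y. (block_row \<phi> (\<nu> \<cdot>\<^sub>v w))\<^sup>T *\<^sub>v y) ` carrier_vec 3"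
    using red_plane_eq[OF w] by blast
  obtain y where y: "y \<in> carrier_vec 3" "x = (block_row \<phi> (\<mu> \<cdot>\<^sub>v v))\<^sup>T *\<^sub>v y"
    using x(1) unfolding \<mu>(2) by blast
  obtain z where z: "z \<in> carrier_vec 3" "x = (block_row \<phi> (\<nu> \<cdot>\<^sub>v w))\<^sup>T *\<^sub>v z"
    using x(2) unfolding \<nu>(2) by blast
  have blocks: "(\<phi> (\<mu> * v $ l))\<^sup>T *\<^sub>v y = (\<phi> (\<nu> * w $ l))\<^sup>T *\<^sub>v z" if "l < t" for l
    using vec_block_transpose_block_row[of "\<mu> \<cdot>\<^sub>v v" t y l] vec_block_transpose_block_row[of "\<nu> \<cdot>\<^sub>v w" t z l]
      that v w y z by simp
  have z0: "z \<noteq> 0\<^sub>v 3"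
  proof
    assume "z = 0\<^sub>v 3"
    then have "x = 0\<^sub>v (3 * t)"
      using z(2) block_row_carrier[of "\<nu> \<cdot>\<^sub>v w" t] w by (auto intro!: eq_vecI)
    with x(3) show False by blast
  qed
  obtain l where l: "l < t" "v $ l \<noteq> 0"
    using v by (metis carrier_vecD eq_vecI index_zero_vec)
  \<comment> \<open>The quotient of the two coefficients in block \<open>l\<close>, chosen to make
    \<open>y = (\<phi> \<kappa>)\<^sup>T *\<^sub>v z\<close>.\<close>
  define \<kappa> where "\<kappa> = \<nu> * w $ l / (\<mu> * v $ l)"
  have "(\<phi> (\<mu> * v $ l))\<^sup>T *\<^sub>v y = (\<phi> (\<mu> * v $ l))\<^sup>T *\<^sub>v ((\<phi> \<kappa>)\<^sup>T *\<^sub>v z)"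
    unfolding blocks[OF l(1)] T.act_mult[OF z(1)] using l \<mu> by (simp add: \<kappa>_def)
  then have yz: "y = (\<phi> \<kappa>)\<^sup>T *\<^sub>v z"
    using T.act_left_cancel[OF y(1) T.act_carrier, of "\<mu> * v $ l" \<kappa> z] l \<mu> by simp
  have "w $ i = (\<mu> * \<kappa> / \<nu>) * v $ i" if i: "i < t" for i
  proof -
    have "(\<phi> (\<mu> * v $ i * \<kappa>))\<^sup>T *\<^sub>v z = (\<phi> (\<nu> * w $ i))\<^sup>T *\<^sub>v z"
      using blocks[OF i] unfolding yz T.act_mult[OF z(1)] .
    then have "\<mu> * v $ i * \<kappa> = \<nu> * w $ i"
      by (rule T.act_right_cancel[OF z(1) z0])
    then show ?thesis
      using \<nu> by (simp add: field_simps)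
  qed
  then have "w = (\<mu> * \<kappa> / \<nu>) \<cdot>\<^sub>v v"
    using v w by (intro eq_vecI) auto
  then show ?thesis by blast
qed

end

subsection \<open>The planes of the construction\<close>

locale D_construction = field_reduction_rep \<phi>
  for \<phi> :: "'b::{finite,field} \<Rightarrow> 'a::{finite,field} mat" +
  fixes emb :: "'a \<Rightarrow> 'b" and \<gamma> :: 'b and t :: nat and i j :: "nat \<Rightarrow> nat \<Rightarrow> nat"
  assumes emb: "field_hom emb"
    and \<gamma>: "primitive_element \<gamma>"
    and card_ext: "CARD('b) = CARD('a) ^ 3"
    and emb_smult: "\<phi> (emb c * x) = c \<cdot>\<^sub>m \<phi> x"
    and ij: "l < m \<Longrightarrow> m < t \<Longrightarrow>
      (int (j l m) - int (i l m)) mod int (CARD('a)\<^sup>2 + CARD('a) + 1) \<noteq> 0"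
begin

text \<open>
  The pairs \<open>(l, m)\<close> with \<open>l < m\<close> index the points \<open>Q_point \<gamma> t l m (i l m)\<close>, and their
  transposes \<open>(m, l)\<close> the points \<open>Q_point \<gamma> t l m (j l m)\<close>.
\<close>

definition D_vec :: "nat \<times> nat \<Rightarrow> 'b vec" where
  "D_vec = (\<lambda>(l, m). if l = m then unit_vec t l
     else if l < m then unit_vec t l + \<gamma> ^ i l m \<cdot>\<^sub>v unit_vec t m
     else unit_vec t m + \<gamma> ^ j m l \<cdot>\<^sub>v unit_vec t l)"

abbreviation idx :: "(nat \<times> nat) set" where
  "idx \<equiv> {..<t} \<times> {..<t}"

lemma \<gamma>_nonzero: "\<gamma> \<noteq> 0"
  using \<gamma> unfolding primitive_element_def by (metis ComplD power_one_right rangeI singletonI)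

text \<open>The condition on \<open>i\<close> and \<open>j\<close> in the form used below: the two
  powers of \<gamma> lie in different cosets of the nonzero elements of F_q.\<close>

lemma ratio_neq:
  assumes "l < m" "m < t" "c \<noteq> 0" "d \<noteq> 0"
  shows "\<gamma> ^ i l m * emb c \<noteq> \<gamma> ^ j l m * emb d"
  using primitive_power_ratio[OF emb \<gamma> card_ext _ assms(3,4)] ij[OF assms(1,2)] by blast

lemma power_i_neq_power_j:
  assumes "l < m" "m < t"
  shows "\<gamma> ^ i l m \<noteq> \<gamma> ^ j l m"
proof -
  interpret field_hom emb by (rule emb)
  show ?thesis
    using ratio_neq[OF assms, of 1 1] by simp
qed

lemma D_vec_carrier [simp]: "D_vec p \<in> carrier_vec t"
  by (auto simp: D_vec_def split: prod.split)

lemma D_vec_nth_eq_0_iff: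
  assumes "(l, m) \<in> idx" "c < t"
  shows "D_vec (l, m) $ c = 0 \<longleftrightarrow> c \<noteq> l \<and> c \<noteq> m"
  using assms \<gamma>_nonzero by (auto simp: D_vec_def)

lemma D_vec_nonzero:
  assumes "p \<in> idx"
  shows "D_vec p \<noteq> 0\<^sub>v t"
proof -
  obtain l m where p: "p = (l, m)" "l < t" "m < t"
    using assms by auto
  then have "D_vec p $ l \<noteq> 0"
    using D_vec_nth_eq_0_iff[of l m l] by auto
  then show ?thesis
    using p by auto
qed

text \<open>Proportional vectors have equal support, which determines the index pair up to order.
  For an off-diagonal pair and its transpose, a common entry 1 forces \<kappa> = 1, and then the
  powers given by \<open>i\<close> and \<open>j\<close> would agree.\<close>

lemma D_vec_proportional_imp_eq:
  assumes p: "p \<in> idx" and p': "p' \<in> idx" and e: "D_vec p' = \<kappa> \<cdot>\<^sub>v D_vec p"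
  shows "p = p'"
proof -
  obtain l m l' m' where lm: "p = (l, m)" "p' = (l', m')"
    by (cases p, cases p')
  have less: "l < t" "m < t" "l' < t" "m' < t"
    using p p' lm by auto
  have val: "D_vec p' $ c = \<kappa> * D_vec p $ c" if "c < t" for c
    using arg_cong[OF e, of "\<lambda>v. v $ c"] that carrier_vecD[OF D_vec_carrier[of p]] by simp
  have "\<kappa> \<noteq> 0"
    using D_vec_nonzero[OF p'] e smult_eq_zero_vec_iff[OF D_vec_carrier[of p]] by auto
  then have supp: "(c \<noteq> l' \<and> c \<noteq> m') \<longleftrightarrow> (c \<noteq> l \<and> c \<noteq> m)" if "c < t" for c
    using val[OF that] D_vec_nth_eq_0_iff[OF _ that, of l m] D_vec_nth_eq_0_iff[OF _ that, of l' m']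
      p p' unfolding lm by simp
  have False if "l \<noteq> m" "l' = m" "m' = l"
  proof -
    \<comment> \<open>Both vectors have entry 1 at the smaller index and the power of \<gamma> at
      the larger.\<close>
    define u v where "u = min l m" and "v = max l m"
    have uv: "u < v" "v < t"
      using that less by (auto simp: u_def v_def)
    have "{D_vec p $ v, D_vec p' $ v} = {\<gamma> ^ i u v, \<gamma> ^ j u v}"
      using that less uv unfolding lm u_def v_def
      by (cases "l < m") (auto simp: D_vec_def min_def max_def)
    moreover have "D_vec p $ u = 1" "D_vec p' $ u = 1"
      using that less unfolding lm u_def v_def by (auto simp: D_vec_def min_def)
    then have "\<kappa> = 1"
      using val[of u] uv by simp
    then have "D_vec p' $ v = D_vec p $ v"
      using val[OF uv(2)] by simp
    ultimately show False
      using power_i_neq_power_j[OF uv] by (auto simp: doubleton_eq_iff)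
  qed
  then show ?thesis
    using supp[OF less(1)] supp[OF less(2)] supp[OF less(3)] supp[OF less(4)] unfolding lm by auto
qed

definition D_plane :: "nat \<times> nat \<Rightarrow> 'a vec set" where
  "D_plane p = red_plane t (D_vec p)"

lemma D_plane_in_subspaces: "p \<in> idx \<Longrightarrow> D_plane p \<in> subspaces_of_dim (3 * t) 3"
  unfolding D_plane_def by (intro red_plane_in_subspaces D_vec_carrier D_vec_nonzero)

lemma D_planes_eq: "D_planes \<gamma> \<phi> t i j = D_plane ` idx"
proof -
  have "{P_point t l | l. l < t} \<union> {Q_point \<gamma> t l m (i l m) | l m. l < m \<and> m < t} \<union>
      {Q_point \<gamma> t l m (j l m) | l m. l < m \<and> m < t} = (\<lambda>p. proj_point (D_vec p)) ` idx" (is "?L = ?R")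
  proof (intro equalityI subsetI)
    fix P assume "P \<in> ?L"
    then consider l where "P = P_point t l" "l < t"
      | l m where "P = Q_point \<gamma> t l m (i l m)" "l < m" "m < t"
      | l m where "P = Q_point \<gamma> t l m (j l m)" "l < m" "m < t"
      by blast
    then show "P \<in> ?R"
    proof cases
      case (1 l)
      then show ?thesis
        by (intro image_eqI[of _ _ "(l, l)"]) (auto simp: D_vec_def P_point_def)
    next
      case (2 l m)
      then show ?thesis
        by (intro image_eqI[of _ _ "(l, m)"]) (auto simp: D_vec_def Q_point_def)
    next
      case (3 l m)
      then show ?thesis
        by (intro image_eqI[of _ _ "(m, l)"]) (auto simp: D_vec_def Q_point_def)
    qed
  next
    fix P assume "P \<in> ?R"
    then obtain l m where P: "P = proj_point (D_vec (l, m))" "l < t" "m < t"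
      by auto
    show "P \<in> ?L"
    proof (cases l m rule: linorder_cases)
      case less
      then have "P = Q_point \<gamma> t l m (i l m)"
        using P by (simp add: D_vec_def Q_point_def)
      with less P show ?thesis by blast
    next
      case equal
      then have "P = P_point t l"
        using P by (simp add: D_vec_def P_point_def)
      with P show ?thesis by blast
    next
      case greater
      then have "P = Q_point \<gamma> t m l (j m l)"
        using P by (simp add: D_vec_def Q_point_def)
      with greater P show ?thesis by blast
    qed
  qed
  then show ?thesis
    unfolding D_planes_def D_plane_def red_plane_def by (simp only: image_image)
qed

lemma D_plane_common_point:
  assumes "p \<in> idx" "p' \<in> idx" "P \<in> subspaces_of_dim (3 * t) 1" "P \<subseteq> D_plane p" "P \<subseteq> D_plane p'"
  shows "p = p'"
proof -
  obtain x where x: "x \<in> P" "x \<noteq> 0\<^sub>v (3 * t)"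
    using subspace_nonzero_vector[OF assms(3)] by blast
  then have "x \<in> red_plane t (D_vec p)" "x \<in> red_plane t (D_vec p')"
    using assms unfolding D_plane_def by auto
  then obtain \<kappa> where "D_vec p' = \<kappa> \<cdot>\<^sub>v D_vec p"
    using red_planes_common_vector[OF D_vec_carrier D_vec_nonzero D_vec_carrier D_vec_nonzero]
      assms(1,2) x(2) by blast
  then show ?thesis
    using D_vec_proportional_imp_eq[OF assms(1,2)] by blast
qed

section \<open>Restrictions of a functional to the planes\<close>

lemma block_row_unit_mult:
  assumes "l < t" "a \<in> carrier_vec (3 * t)"
  shows "block_row \<phi> (unit_vec t l) *\<^sub>v a = vec_block a l"
proof (rule eq_vecI)
  fix r assume "r < dim_vec (vec_block a l)"
  then have r: "r < 3"
    by (simp add: vec_block_def)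
  have "(block_row \<phi> (unit_vec t l) *\<^sub>v a) $ r = (\<Sum>c<t. (\<phi> (unit_vec t l $ c) *\<^sub>v vec_block a c) $ r)"
    by (rule block_row_mult_nth[OF _ assms(2) r]) simp
  also have "\<dots> = (\<Sum>c\<in>{l}. (\<phi> (unit_vec t l $ c) *\<^sub>v vec_block a c) $ r)"
    using assms(1) r by (intro sum.mono_neutral_right) (auto simp del: index_mult_mat_vec)
  finally show "(block_row \<phi> (unit_vec t l) *\<^sub>v a) $ r = vec_block a l $ r"
    using assms(1) by (simp add: act_one del: index_mult_mat_vec)
qed (simp add: block_row_def vec_block_def)

lemma block_row_pair_mult:
  assumes lm: "l < t" "m < t" "l \<noteq> m" and a: "a \<in> carrier_vec (3 * t)"
  shows "block_row \<phi> (unit_vec t l + x \<cdot>\<^sub>v unit_vec t m) *\<^sub>v a = vec_block a l + \<phi> x *\<^sub>v vec_block a m"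
proof (rule eq_vecI)
  let ?v = "unit_vec t l + x \<cdot>\<^sub>v unit_vec t m"
  fix r assume "r < dim_vec (vec_block a l + \<phi> x *\<^sub>v vec_block a m)"
  then have r: "r < 3"
    by simp
  have "(block_row \<phi> ?v *\<^sub>v a) $ r = (\<Sum>c<t. (\<phi> (?v $ c) *\<^sub>v vec_block a c) $ r)"
    by (rule block_row_mult_nth[OF _ a r]) simp
  also have "\<dots> = (\<Sum>c\<in>{l, m}. (\<phi> (?v $ c) *\<^sub>v vec_block a c) $ r)"
    using lm r by (intro sum.mono_neutral_right) (auto simp del: index_mult_mat_vec)
  also have "\<dots> = (vec_block a l + \<phi> x *\<^sub>v vec_block a m) $ r"
    using lm r by (simp add: act_one del: index_mult_mat_vec)
  finally show "(block_row \<phi> ?v *\<^sub>v a) $ r = (vec_block a l + \<phi> x *\<^sub>v vec_block a m) $ r" .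
qed (simp add: block_row_def)

text \<open>Represents the restriction of the functional \<open>a\<close> to
  \<open>D_plane p\<close>, up to the invertible factor \<open>\<phi> \<mu>\<close> that comes from
  the choice of representative.\<close>

definition D_val :: "'a vec \<Rightarrow> nat \<times> nat \<Rightarrow> 'a vec" where
  "D_val a p = block_row \<phi> (D_vec p) *\<^sub>v a"

lemma D_val_diag: "l < t \<Longrightarrow> a \<in> carrier_vec (3 * t) \<Longrightarrow> D_val a (l, l) = vec_block a l"
  by (simp add: D_val_def D_vec_def block_row_unit_mult)

lemma D_val_upper:
  "l < m \<Longrightarrow> m < t \<Longrightarrow> a \<in> carrier_vec (3 * t) \<Longrightarrow>
    D_val a (l, m) = vec_block a l + \<phi> (\<gamma> ^ i l m) *\<^sub>v vec_block a m"
  by (simp add: D_val_def D_vec_def block_row_pair_mult)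

lemma D_val_lower:
  "l < m \<Longrightarrow> m < t \<Longrightarrow> a \<in> carrier_vec (3 * t) \<Longrightarrow>
    D_val a (m, l) = vec_block a l + \<phi> (\<gamma> ^ j l m) *\<^sub>v vec_block a m"
  by (simp add: D_val_def D_vec_def block_row_pair_mult)

lemma D_val_eq_zero_if_subset_hyperplane:
  "p \<in> idx \<Longrightarrow> a \<in> carrier_vec (3 * t) \<Longrightarrow> D_plane p \<subseteq> hyperplane a \<Longrightarrow> D_val a p = 0\<^sub>v 3"
  unfolding D_plane_def D_val_def
  by (rule red_plane_subset_hyperplane_imp[OF D_vec_carrier D_vec_nonzero])

lemma D_val_proportional:
  "p \<in> idx \<Longrightarrow> a \<in> carrier_vec (3 * t) \<Longrightarrow> b \<in> carrier_vec (3 * t) \<Longrightarrow>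
    (\<And>x. x \<in> D_plane p \<Longrightarrow> b \<bullet> x = c * (a \<bullet> x)) \<Longrightarrow> D_val b p = c \<cdot>\<^sub>v D_val a p"
  unfolding D_plane_def D_val_def
  by (rule red_plane_proportional[OF D_vec_carrier D_vec_nonzero])

lemma emb_act:
  assumes "u \<in> carrier_vec 3"
  shows "c \<cdot>\<^sub>v (\<phi> x *\<^sub>v u) = \<phi> (x * emb c) *\<^sub>v u"
proof -
  have "\<phi> (x * emb c) = c \<cdot>\<^sub>m \<phi> x"
    using emb_smult[of c x] by (simp add: mult.commute)
  then show ?thesis
    using assms by (auto intro!: eq_vecI simp: scalar_prod_def sum_distrib_left mult.assoc)
qed

text \<open>With \<open>Y = \<phi> x *\<^sub>v V\<close> the equation reads (c - s) U = (s - d) Y.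
  Here c = s is impossible, since then (c - d) Y = 0; so \<open>U\<close> is an F_q-multiple of
  \<open>Y\<close>.\<close>

lemma unequal_coefficients_imp_ratio:
  assumes U: "U \<in> carrier_vec 3" "U \<noteq> 0\<^sub>v 3" and V: "V \<in> carrier_vec 3" "V \<noteq> 0\<^sub>v 3"
    and x: "x \<noteq> 0" and "c \<noteq> d"
    and e: "c \<cdot>\<^sub>v U + \<phi> x *\<^sub>v (d \<cdot>\<^sub>v V) = s \<cdot>\<^sub>v (U + \<phi> x *\<^sub>v V)"
  shows "\<exists>r. r \<noteq> 0 \<and> U = \<phi> (x * emb r) *\<^sub>v V"
proof -
  define Y where "Y = \<phi> x *\<^sub>v V"
  have Y: "Y \<in> carrier_vec 3" "Y \<noteq> 0\<^sub>v 3"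
    using act_eq_zero_iff[OF V(1)] V x by (auto simp: Y_def)
  have "\<phi> x *\<^sub>v (d \<cdot>\<^sub>v V) = d \<cdot>\<^sub>v Y"
    unfolding Y_def by (rule mult_mat_vec[OF carrier V(1)])
  then have e': "c \<cdot>\<^sub>v U + d \<cdot>\<^sub>v Y = s \<cdot>\<^sub>v (U + Y)"
    using e by (simp add: Y_def)
  have coord: "(c - s) * U $ n = (s - d) * Y $ n" if "n < 3" for n
  proof -
    have "c * U $ n + d * Y $ n = s * (U $ n + Y $ n)"
      using arg_cong[OF e', of "\<lambda>v. v $ n"] that U(1) Y(1) by simp
    then show ?thesis
      by (simp add: algebra_simps)
  qed
  have "c \<noteq> s"
  proof
    assume "c = s"
    obtain n where "n < 3" "Y $ n \<noteq> 0"
      using Y by (metis carrier_vecD eq_vecI index_zero_vec)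
    with coord[of n] \<open>c = s\<close> \<open>c \<noteq> d\<close> show False by simp
  qed
  define r where "r = (s - d) / (c - s)"
  have Ur: "U = r \<cdot>\<^sub>v Y"
    using coord \<open>c \<noteq> s\<close> U Y by (intro eq_vecI) (auto simp: r_def field_simps)
  then have "r \<noteq> 0"
    using U(2) smult_eq_zero_vec_iff[OF Y(1)] by auto
  moreover have "U = \<phi> (x * emb r) *\<^sub>v V"
    unfolding Ur Y_def by (rule emb_act[OF V(1)])
  ultimately show ?thesis by blast
qed

text \<open>The diagonal planes give a factor \<open>C l\<close> for each block. If two nonzero
  blocks had different factors, both planes of that index pair would fix their ratio up to F_q, in
  two incompatible cosets.\<close>

lemma D_val_all_proportional_imp:
  assumes a: "a \<in> carrier_vec (3 * t)" and b: "b \<in> carrier_vec (3 * t)"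
    and pr: "\<And>p. p \<in> idx \<Longrightarrow> \<exists>c. D_val b p = c \<cdot>\<^sub>v D_val a p"
  shows "\<exists>c. b = c \<cdot>\<^sub>v a"
proof -
  have "\<exists>c. vec_block b l = c \<cdot>\<^sub>v vec_block a l" if "l < t" for l
    using pr[of "(l, l)"] that by (simp add: D_val_diag a b)
  then obtain C where C: "\<And>l. l < t \<Longrightarrow> vec_block b l = C l \<cdot>\<^sub>v vec_block a l"
    by metis
  have C_eq: "C l = C m"
    if lm: "l < m" "m < t" and nz: "vec_block a l \<noteq> 0\<^sub>v 3" "vec_block a m \<noteq> 0\<^sub>v 3" for l m
  proof (rule ccontr)
    assume ne: "C l \<noteq> C m"
    have lt: "l < t"
      using lm by simp
    obtain s where s: "C l \<cdot>\<^sub>v vec_block a l + \<phi> (\<gamma> ^ i l m) *\<^sub>v (C m \<cdot>\<^sub>v vec_block a m) =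
        s \<cdot>\<^sub>v (vec_block a l + \<phi> (\<gamma> ^ i l m) *\<^sub>v vec_block a m)"
      using pr[of "(l, m)"] lm lt by (auto simp: D_val_upper a b C)
    obtain s' where s': "C l \<cdot>\<^sub>v vec_block a l + \<phi> (\<gamma> ^ j l m) *\<^sub>v (C m \<cdot>\<^sub>v vec_block a m) =
        s' \<cdot>\<^sub>v (vec_block a l + \<phi> (\<gamma> ^ j l m) *\<^sub>v vec_block a m)"
      using pr[of "(m, l)"] lm lt by (auto simp: D_val_lower a b C)
    obtain r where r: "r \<noteq> 0" "vec_block a l = \<phi> (\<gamma> ^ i l m * emb r) *\<^sub>v vec_block a m"
      using unequal_coefficients_imp_ratio[OF vec_block_carrier nz(1) vec_block_carrier nz(2) _ ne s]
        \<gamma>_nonzero by auto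
    obtain r' where r': "r' \<noteq> 0" "vec_block a l = \<phi> (\<gamma> ^ j l m * emb r') *\<^sub>v vec_block a m"
      using unequal_coefficients_imp_ratio[OF vec_block_carrier nz(1) vec_block_carrier nz(2) _ ne s']
        \<gamma>_nonzero by auto
    have "\<gamma> ^ i l m * emb r = \<gamma> ^ j l m * emb r'"
      by (rule act_right_cancel[OF vec_block_carrier nz(2)]) (simp only: r(2)[symmetric] r'(2)[symmetric])
    then show False
      using ratio_neq[OF lm r(1) r'(1)] by blast
  qed
  \<comment> \<open>A zero block puts no condition on its factor, so only nonzero blocks determine
    \<open>c\<close>; without any, \<open>c\<close> is arbitrary.\<close>
  obtain c where c: "C l = c" if "l < t" "vec_block a l \<noteq> 0\<^sub>v 3" for l
  proof (cases "\<exists>l0<t. vec_block a l0 \<noteq> 0\<^sub>v 3")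
    case True
    then obtain l0 where "l0 < t" "vec_block a l0 \<noteq> 0\<^sub>v 3"
      by blast
    then have "C l = C l0" if "l < t" "vec_block a l \<noteq> 0\<^sub>v 3" for l
      using C_eq that by (metis linorder_neq_iff)
    then show ?thesis
      by (rule that)
  qed (use that in blast)
  have "b = c \<cdot>\<^sub>v a"
  proof (rule vec_eq_if_blocks_eq[OF b])
    fix l assume l: "l < t"
    have "C l \<cdot>\<^sub>v vec_block a l = c \<cdot>\<^sub>v vec_block a l"
      using c[OF l] by (cases "vec_block a l = 0\<^sub>v 3") (auto intro!: eq_vecI)
    then show "vec_block b l = vec_block (c \<cdot>\<^sub>v a) l"
      using C[OF l] vec_block_smult[OF a l] by simp
  qed (use a in simp)
  then show ?thesis by blast
qed

text \<open>
  Fix a nonzero block \<open>l0\<close> of \<open>a\<close>. For every other \<open>m\<close>, at least two of the three values at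
  \<open>(l0, m)\<close>, \<open>(m, l0)\<close>, \<open>(m, m)\<close> are nonzero.
\<close>

lemma card_D_val_nonzero:
  assumes a: "a \<in> carrier_vec (3 * t)" "a \<noteq> 0\<^sub>v (3 * t)"
  shows "2 * t - 1 \<le> card {p \<in> idx. D_val a p \<noteq> 0\<^sub>v 3}"
proof -
  obtain l0 where l0: "l0 < t" "vec_block a l0 \<noteq> 0\<^sub>v 3"
    using vec_eq_if_blocks_eq[OF a(1) zero_carrier_vec] a(2) vec_block_zero by metis
  \<comment> \<open>For \<open>m \<noteq> l0\<close> these sets are pairwise disjoint: the indices
    in \<open>T m\<close> involve \<open>m\<close> and otherwise only \<open>l0\<close>.\<close>
  define T where "T m = {p \<in> {(l0, m), (m, l0), (m, m)}. D_val a p \<noteq> 0\<^sub>v 3}" for m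
  have T2: "card (T m) \<ge> 2" if m: "m < t" "m \<noteq> l0" for m
  proof -
    \<comment> \<open>Values off the diagonal are computed with the smaller index first, so the pair
      is sorted.\<close>
    define u v where "u = min l0 m" and "v = max l0 m"
    have uv: "u < v" "v < t"
      using m l0 by (auto simp: u_def v_def)
    have sets: "{(l0, m), (m, l0)} = {(u, v), (v, u)}" and uvs: "{u, v} = {l0, m}"
      by (auto simp: u_def v_def min_def max_def)
    let ?A = "vec_block a u" and ?B = "vec_block a v"
    have vals: "D_val a (u, v) = ?A + \<phi> (\<gamma> ^ i u v) *\<^sub>v ?B" "D_val a (v, u) = ?A + \<phi> (\<gamma> ^ j u v) *\<^sub>v ?B"
      using D_val_upper[OF uv a(1)] D_val_lower[OF uv a(1)] by auto
    have ge2: "card (T m) \<ge> 2" if "p \<in> T m" "p' \<in> T m" "p \<noteq> p'" for p p'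
    proof -
      have "card {p, p'} \<le> card (T m)"
        using that by (intro card_mono) (auto simp: T_def)
      then show ?thesis
        using that by simp
    qed
    show ?thesis
    proof (cases "vec_block a m = 0\<^sub>v 3")
      case True
      \<comment> \<open>With block \<open>m\<close> zero, both values off the diagonal are block
        \<open>l0\<close> up to a power of \<gamma>, hence nonzero.\<close>
      have nz: "?A + \<phi> (\<gamma> ^ e) *\<^sub>v ?B \<noteq> 0\<^sub>v 3" for e
      proof (cases "u = l0")
        case True
        then have "v = m"
          using uvs uv by auto
        then show ?thesis
          using True l0 \<open>vec_block a m = 0\<^sub>v 3\<close> right_zero_vec[OF vec_block_carrier, of a u] by simp
      next
        case False
        then have "u = m" "v = l0"
          using uvs uv by (auto simp: doubleton_eq_iff)
        then show ?thesis
          using l0 \<open>vec_block a m = 0\<^sub>v 3\<close> act_eq_zero_iff[OF vec_block_carrier[of a l0], of "\<gamma> ^ e"] \<gamma>_nonzero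
            left_zero_vec[OF act_carrier, of "\<gamma> ^ e" ?B] by simp
      qed
      have "(u, v) \<in> T m" "(v, u) \<in> T m"
        using sets nz vals unfolding T_def by auto
      then show ?thesis
        using ge2 uv by fastforce
    next
      case False
      then have mm: "(m, m) \<in> T m"
        using D_val_diag[OF m(1) a(1)] by (simp add: T_def)
      have "?B \<noteq> 0\<^sub>v 3"
        using False l0 uvs by (auto simp: v_def max_def)
      \<comment> \<open>The two values off the diagonal differ, so they are not both zero; one of
        them joins \<open>(m, m)\<close>.\<close>
      then have "\<phi> (\<gamma> ^ i u v) *\<^sub>v ?B \<noteq> \<phi> (\<gamma> ^ j u v) *\<^sub>v ?B"
        using act_right_cancel[OF vec_block_carrier] power_i_neq_power_j[OF uv] by blast
      then have "D_val a (u, v) \<noteq> 0\<^sub>v 3 \<or> D_val a (v, u) \<noteq> 0\<^sub>v 3"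
        unfolding vals using add_eq_zero_vec_cancel[OF vec_block_carrier act_carrier act_carrier] by blast
      then obtain p where "p \<in> {(u, v), (v, u)}" "D_val a p \<noteq> 0\<^sub>v 3"
        by blast
      then have "p \<in> T m" "p \<noteq> (m, m)"
        using sets uv unfolding T_def by auto
      then show ?thesis
        using ge2[OF _ mm] by blast
    qed
  qed
  let ?M = "{..<t} - {l0}"
  \<comment> \<open>One for \<open>(l0, l0)\<close> and two for each of the remaining t - 1
    indices.\<close>
  have "2 * t - 1 = 1 + (\<Sum>m\<in>?M. 2)"
    using l0 by (simp add: card_Diff_singleton)
  also have "\<dots> \<le> 1 + (\<Sum>m\<in>?M. card (T m))"
    using T2 by (intro add_left_mono sum_mono) auto
  also have "\<dots> = card {(l0, l0)} + card (\<Union>m\<in>?M. T m)"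
    by (subst card_UN_disjoint) (auto simp: T_def)
  also have "\<dots> = card ({(l0, l0)} \<union> (\<Union>m\<in>?M. T m))"
    by (rule card_Un_disjoint[symmetric]) (auto simp: T_def)
  also have "\<dots> \<le> card {p \<in> idx. D_val a p \<noteq> 0\<^sub>v 3}"
    using l0 D_val_diag[OF l0(1) a(1)] by (intro card_mono) (auto simp: T_def)
  finally show ?thesis .
qed

end

section \<open>Length, weights and the cutting property of the point set\<close>

context D_construction
begin

definition D_pair :: "('a vec set \<Rightarrow> 'a vec set set) \<Rightarrow> ('a vec set \<Rightarrow> 'a vec set set) \<Rightarrow>
    nat \<times> nat \<Rightarrow> 'a vec set set" where
  "D_pair B1 B2 p = B1 (D_plane p) \<union> B2 (D_plane p)"

context
  fixes B1 B2 :: "'a vec set \<Rightarrow> 'a vec set set"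
  assumes baer: "\<And>p. p \<in> idx \<Longrightarrow>
    baer_subplane TYPE('c::{finite,field}) (3 * t) (D_plane p) (B1 (D_plane p)) \<and>
    baer_subplane TYPE('c) (3 * t) (D_plane p) (B2 (D_plane p)) \<and>
    B1 (D_plane p) \<inter> B2 (D_plane p) = {}"
begin

lemma D_pair_point:
  assumes "p \<in> idx" "P \<in> D_pair B1 B2 p"
  shows "P \<in> subspaces_of_dim (3 * t) 1" "P \<subseteq> D_plane p"
  using assms baer[OF assms(1)] baer_point[OF _ D_plane_in_subspaces[OF assms(1)]]
  unfolding D_pair_def by blast+

lemma finite_D_pair: "p \<in> idx \<Longrightarrow> finite (D_pair B1 B2 p)"
  unfolding D_pair_def using baer finite_baer[OF _ D_plane_in_subspaces] by blast

lemma D_pair_disjoint: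
  assumes "p \<in> idx" "p' \<in> idx" "p \<noteq> p'"
  shows "D_pair B1 B2 p \<inter> D_pair B1 B2 p' = {}"
  using D_plane_common_point[OF assms(1,2)] D_pair_point[OF assms(1)] D_pair_point[OF assms(2)] assms(3)
  by blast

lemma card_D_pair: "p \<in> idx \<Longrightarrow> card (D_pair B1 B2 p) = 2 * (CARD('c)\<^sup>2 + CARD('c) + 1)"
  unfolding D_pair_def using baer[of p] card_baer[OF _ D_plane_in_subspaces[of p]]
    finite_baer[OF _ D_plane_in_subspaces[of p]]
  by (subst card_Un_disjoint) auto

lemma card_D_points: "card (\<Union>p\<in>idx. D_pair B1 B2 p) = t\<^sup>2 * (2 * (CARD('c)\<^sup>2 + CARD('c) + 1))"
proof -
  have "card (\<Union>p\<in>idx. D_pair B1 B2 p) = (\<Sum>p\<in>idx. card (D_pair B1 B2 p))"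
    using finite_D_pair D_pair_disjoint by (intro card_UN_disjoint) auto
  also have "\<dots> = (\<Sum>p\<in>idx. 2 * (CARD('c)\<^sup>2 + CARD('c) + 1))"
    by (intro sum.cong refl) (rule card_D_pair)
  also have "\<dots> = t\<^sup>2 * (2 * (CARD('c)\<^sup>2 + CARD('c) + 1))"
    by (simp add: card_cartesian_product power2_eq_square)
  finally show ?thesis .
qed

text \<open>Every plane on which \<open>a\<close> is nonzero contributes at least q points from each
  of its two Baer subplanes, and contributions of different planes are disjoint.\<close>

lemma D_points_weight:
  assumes a: "a \<in> carrier_vec (3 * t)" "a \<noteq> 0\<^sub>v (3 * t)"
  shows "2 * CARD('a) * (2 * t - 1) \<le> card {P \<in> (\<Union>p\<in>idx. D_pair B1 B2 p). \<not> P \<subseteq> hyperplane a}"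
proof -
  let ?off = "\<lambda>S. {P \<in> S. \<not> P \<subseteq> hyperplane a}"
  let ?nz = "{p \<in> idx. D_val a p \<noteq> 0\<^sub>v 3}"
  have ge: "2 * CARD('a) \<le> card (?off (D_pair B1 B2 p))" if p: "p \<in> ?nz" for p
  proof -
    have p': "p \<in> idx" and ns: "\<not> D_plane p \<subseteq> hyperplane a"
      using p D_val_eq_zero_if_subset_hyperplane[OF _ a(1)] by auto
    note B = baer[OF p'] and pl = D_plane_in_subspaces[OF p']
    have off: "?off (D_pair B1 B2 p) = ?off (B1 (D_plane p)) \<union> ?off (B2 (D_plane p))"
      unfolding D_pair_def by blast
    have "card (?off (D_pair B1 B2 p)) = card (?off (B1 (D_plane p))) + card (?off (B2 (D_plane p)))"
      unfolding off using B finite_baer[OF _ pl] by (intro card_Un_disjoint) auto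
    then show ?thesis
      using baer_off_hyperplane_ge[OF conjunct1[OF B] pl a(1) ns]
        baer_off_hyperplane_ge[OF conjunct1[OF conjunct2[OF B]] pl a(1) ns] by simp
  qed
  have "2 * CARD('a) * (2 * t - 1) \<le> 2 * CARD('a) * card ?nz"
    using card_D_val_nonzero[OF a] by (rule mult_left_mono) simp
  also have "\<dots> = (\<Sum>p\<in>?nz. 2 * CARD('a))"
    by (simp add: mult.commute)
  also have "\<dots> \<le> (\<Sum>p\<in>?nz. card (?off (D_pair B1 B2 p)))"
    by (rule sum_mono) (rule ge)
  also have "\<dots> = card (\<Union>p\<in>?nz. ?off (D_pair B1 B2 p))"
  proof (rule card_UN_disjoint[symmetric])
    show "\<forall>p\<in>?nz. finite (?off (D_pair B1 B2 p))"
      using finite_D_pair by auto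
    show "\<forall>p\<in>?nz. \<forall>p'\<in>?nz. p \<noteq> p' \<longrightarrow> ?off (D_pair B1 B2 p) \<inter> ?off (D_pair B1 B2 p') = {}"
      using D_pair_disjoint by blast
  qed simp
  also have "\<dots> \<le> card (?off (\<Union>p\<in>idx. D_pair B1 B2 p))"
    using finite_D_pair by (intro card_mono) auto
  finally show ?thesis .
qed

text \<open>The two Baer subplanes make \<open>b\<close> proportional to \<open>a\<close> on every
  plane, with a factor that may depend on the plane; \<open>D_val_all_proportional_imp\<close> makes
  the factor global.\<close>

lemma D_points_cutting:
  assumes a: "a \<in> carrier_vec (3 * t)" and b: "b \<in> carrier_vec (3 * t)"
    and ab: "\<And>P. P \<in> (\<Union>p\<in>idx. D_pair B1 B2 p) \<Longrightarrow> P \<subseteq> hyperplane a \<Longrightarrow> P \<subseteq> hyperplane b"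
  shows "\<exists>c. b = c \<cdot>\<^sub>v a"
proof (rule D_val_all_proportional_imp[OF a b])
  fix p assume p: "p \<in> idx"
  note B = baer[OF p]
  have "\<exists>c. \<forall>x\<in>D_plane p. b \<bullet> x = c * (a \<bullet> x)"
    using p ab unfolding D_pair_def
    by (intro disjoint_baer_subplanes_functional[OF conjunct1[OF B] conjunct1[OF conjunct2[OF B]]
          conjunct2[OF conjunct2[OF B]] D_plane_in_subspaces[OF p] a b]) blast
  then obtain c where "\<And>x. x \<in> D_plane p \<Longrightarrow> b \<bullet> x = c * (a \<bullet> x)"
    by blast
  then show "\<exists>c. D_val b p = c \<cdot>\<^sub>v D_val a p"
    using D_val_proportional[OF p a b] by blast
qed

end

end

text \<open>\<open>mat_algebra\<close> inherits its operations from the full matrix ring, so \<phi>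
  is a homomorphism into the square matrices whose size is the degree of \<open>f\<close>.\<close>

lemma mat_algebra_iso_rep:
  assumes iso: "is_mat_algebra_iso emb (companion_matrix f) \<phi>" and deg: "degree f = m"
  shows "field_matrix_rep \<phi> m"
proof
  let ?M = "companion_matrix f"
  have dim: "dim_row ?M = m"
    by (simp add: companion_matrix_def deg)
  have hom: "\<phi> \<in> Ring.ring_hom class_ring (mat_algebra ?M)"
    using iso unfolding is_mat_algebra_iso_def ring_iso_def by blast
  fix x y
  have "\<phi> x \<in> carrier (mat_algebra ?M)"
    using ring_hom_closed[OF hom, of x] by simp
  then show "\<phi> x \<in> carrier_mat m m"
    by (auto simp: mat_algebra_def poly_of_mat_def dim)
  show "\<phi> (x + y) = \<phi> x + \<phi> y"
    using ring_hom_add[OF hom, of x y] by (simp add: mat_algebra_def ring_mat_simps)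
  show "\<phi> (x * y) = \<phi> x * \<phi> y"
    using ring_hom_mult[OF hom, of x y] by (simp add: mat_algebra_def ring_mat_simps)
  show "\<phi> 1 = 1\<^sub>m m"
    using ring_hom_one[OF hom] by (simp add: mat_algebra_def ring_mat_simps dim)
qed

theorem proposition4p14:
  fixes emb :: "'a::{finite,field} \<Rightarrow> 'b::{finite,field}"
    and \<gamma> :: 'b
    and f :: "'a poly"
    and \<phi> :: "'b \<Rightarrow> 'a mat"
    and q k t n :: nat
    and i j :: "nat \<Rightarrow> nat \<Rightarrow> nat"
    and B1 B2 :: "'a vec set \<Rightarrow> 'a vec set set"
    and G :: "'a mat"
  assumes q: "CARD('a) = q"
    and q_square: "CARD('c::{finite,field})^2 = q"
    and q3: "CARD('b) = q^3"
    and emb: "field_hom emb"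
    and t: "t \<ge> 1"
    and k: "k = 3 * t"
    and \<gamma>: "primitive_element \<gamma>"
    and f: "is_min_poly emb \<gamma> f"
    and \<phi>: "is_mat_algebra_iso emb (companion_matrix f) \<phi>"
    and \<phi>_\<gamma>: "\<phi> \<gamma> = companion_matrix f"
    and ij: "\<And>l m. l < m \<Longrightarrow> m < t \<Longrightarrow>
           i l m \<in> {1..q^3 - 1} \<and> j l m \<in> {1..q^3 - 1} \<and>
           (int (j l m) - int (i l m)) mod int (q^2 + q + 1) \<noteq> 0"
    and baer: "\<And>\<pi>. \<pi> \<in> D_planes \<gamma> \<phi> t i j \<Longrightarrow>
           baer_subplane TYPE('c) k \<pi> (B1 \<pi>) \<and> baer_subplane TYPE('c) k \<pi> (B2 \<pi>) \<and>
           B1 \<pi> \<inter> B2 \<pi> = {}"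
    and G: "columns_represent k n G (\<Union>\<pi>\<in>D_planes \<gamma> \<phi> t i j. B1 \<pi> \<union> B2 \<pi>)"
  shows "\<exists>d. linear_code n k d (vec_space.row_space n G) \<and>
             minimal_code n (vec_space.row_space n G) \<and>
             real n = (real q + sqrt (real q) + 1) * (2 * real k^2 / 9) \<and>
             real d \<ge> real q * (4 / 3 * real k - 2)"
proof -
  have card_ext: "CARD('b) = CARD('a) ^ 3"
    using q q3 by simp
  have "field_matrix_rep \<phi> 3"
    by (rule mat_algebra_iso_rep[OF \<phi> degree_min_poly[OF emb \<gamma> f card_ext]])
  moreover have "\<phi> (emb c * x) = c \<cdot>\<^sub>m \<phi> x" for c x
    using \<phi> unfolding is_mat_algebra_iso_def by blast
  ultimately interpret D_construction \<phi> emb \<gamma> t i j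
    using emb \<gamma> card_ext ij q
    by (intro D_construction.intro field_reduction_rep.intro D_construction_axioms.intro) auto
  define X where "X = (\<Union>p\<in>idx. D_pair B1 B2 p)"
  \<comment> \<open>Reindexes the union over planes by index pairs, for which disjointness and sizes
    are known.\<close>
  have X: "(\<Union>\<pi>\<in>D_planes \<gamma> \<phi> t i j. B1 \<pi> \<union> B2 \<pi>) = X"
    unfolding X_def D_planes_eq by (simp add: D_pair_def image_image)
  have B: "baer_subplane TYPE('c) (3 * t) (D_plane p) (B1 (D_plane p)) \<and>
      baer_subplane TYPE('c) (3 * t) (D_plane p) (B2 (D_plane p)) \<and>
      B1 (D_plane p) \<inter> B2 (D_plane p) = {}" if "p \<in> idx" for p
    using baer that unfolding D_planes_eq k by blast
  note G' = G[unfolded X k]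
  have "n = card X"
    using G' unfolding columns_represent_def by (metis bij_betw_same_card card_lessThan)
  then have n: "n = t\<^sup>2 * (2 * (CARD('c)\<^sup>2 + CARD('c) + 1))"
    unfolding X_def using card_D_points[OF B] by simp
  have "3 * t \<ge> 1" "2 * CARD('a) * (2 * t - 1) \<ge> 1"
    using t card_field_ge_2[where 'a='a] by auto
  then obtain d where d: "2 * CARD('a) * (2 * t - 1) \<le> d"
    and code: "linear_code n (3 * t) d (vec_space.row_space n G)"
    using linear_code_from_points[OF G' _ _ D_points_weight[OF B, folded X_def]] by blast
  have min: "minimal_code n (vec_space.row_space n G)"
    by (rule minimal_code_from_points[OF G'], unfold X_def) (rule D_points_cutting[OF B])
  have s: "sqrt (real q) = real CARD('c)"
    unfolding q_square[symmetric] by simp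
  \<comment> \<open>From \<open>k = 3 * t\<close> one gets 2 k^2 / 9 = 2 t^2, the number of Baer
    subplanes.\<close>
  have "real n = (real q + sqrt (real q) + 1) * (2 * real k^2 / 9)"
    unfolding n k s q_square[symmetric] by (simp add: power2_eq_square algebra_simps)
  moreover have "real q * (4 / 3 * real k - 2) = real (2 * CARD('a) * (2 * t - 1))"
  proof -
    \<comment> \<open>The natural subtraction is exact because \<open>t \<ge> 1\<close>; with
      \<open>k = 3 * t\<close>, 4 k / 3 - 2 equals 2 (2 t - 1).\<close>
    have "real (2 * t - 1) = 2 * real t - 1"
      using t by (simp add: of_nat_diff)
    then show ?thesis
      unfolding k q of_nat_mult by (simp add: algebra_simps)
  qed
  ultimately show ?thesis
    using code min d unfolding k by (metis of_nat_le_iff)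
qed

end
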